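(* For $0\le\sigma<1$, $$\mathbb{E}[\operatorname{perim} K_\sigma]=\sqrt{2\pi}\left(\sigma+\frac{\arccos\sigma}{\sqrt{1-\sigma^2}}\right),$$ and for $\sigma=1$, $\mathbb{E}[\operatorname{perim} K_1]=\sqrt{8\pi}$.
   Context: Let $B=\{B_t: 0\le t\le 1\}$ be a standard planar ($\mathbb{R}^2$-valued) Brownian bridge from $0$ to $0$ on $[0,1]$, i.e. the continuous centered Gaussian process with covariance $\mathbb{E}[B_sB_t^{T}]=(\min\{s,t\}-st)I$, and let $Z\sim N(0,I)$ be a standard Gaussian vector in $\mathbb{R}^2$ independent of $B$. For $\sigma\in[0,1]$ define $X_\sigma(t)=B_t+\sigma tZ$, $0\le t\le 1$, and let $K_\sigma=\operatorname{hull}\{X_\sigma(t): 0\le t\le 1\}$ be the convex hull of its trajectory. $\operatorname{perim}K$ denotes the perimeter of the compact convex planar set $K$. *)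

theory Defs
  imports "HOL-Probability.Probability"
begin

(* Almost surely constant variables count as (degenerate) Gaussians. *)
definition gaussian_rv :: "'w measure \<Rightarrow> ('w \<Rightarrow> real) \<Rightarrow> bool" where
  "gaussian_rv M Y \<longleftrightarrow> Y \<in> borel_measurable M \<and>
     ((\<exists>c. AE \<omega> in M. Y \<omega> = c) \<or>
      (\<exists>\<mu> s. s > 0 \<and> distributed M lborel Y (normal_density \<mu> s)))"

definition gaussian_process ::
    "'w measure \<Rightarrow> 'i set \<Rightarrow> ('i \<Rightarrow> 'w \<Rightarrow> 'a::euclidean_space) \<Rightarrow> bool" where
  "gaussian_process M T X \<longleftrightarrow>
     (\<forall>t\<in>T. X t \<in> borel_measurable M) \<and>
     (\<forall>J a. finite J \<and> J \<subseteq> T \<longrightarrow> gaussian_rv M (\<lambda>\<omega>. \<Sum>t\<in>J. a t \<bullet> X t \<omega>))"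

(* That the bridge starts and ends at 0 (almost surely) is part of the covariance condition:
   the components of B 0 and B 1 are centred with variance 0. *)
definition planar_brownian_bridge :: "'w measure \<Rightarrow> (real \<Rightarrow> 'w \<Rightarrow> real^2) \<Rightarrow> bool" where
  "planar_brownian_bridge M B \<longleftrightarrow>
     gaussian_process M {0..1} B \<and>
     (\<forall>\<omega>\<in>space M. continuous_on {0..1} (\<lambda>t. B t \<omega>)) \<and>
     (\<forall>t\<in>{0..1}. prob_space.expectation M (B t) = 0) \<and>
     (\<forall>s\<in>{0..1}. \<forall>t\<in>{0..1}. \<forall>i j.
        prob_space.expectation M (\<lambda>\<omega>. B s \<omega> $ i * B t \<omega> $ j)
          = (min s t - s * t) * (mat 1 :: real^2^2) $ i $ j)"

definition std_gaussian_vector :: "'w measure \<Rightarrow> ('w \<Rightarrow> real^2) \<Rightarrow> bool" where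
  "std_gaussian_vector M Z \<longleftrightarrow>
     distributed M lborel Z (\<lambda>z. \<Prod>i\<in>UNIV. std_normal_density (z $ i))"

(* Independence of the sigma-algebra generated by the whole process and the one generated by Z;
   the library's indep_var would force both variables to take values in the same type. *)
definition process_indep_of ::
    "'w measure \<Rightarrow> 'i set \<Rightarrow> ('i \<Rightarrow> 'w \<Rightarrow> 'a::topological_space) \<Rightarrow> ('w \<Rightarrow> 'b::topological_space) \<Rightarrow> bool" where
  "process_indep_of M T X Z \<longleftrightarrow>
     prob_space.indep_set M
       (sets (vimage_algebra (space M) (\<lambda>\<omega>. \<lambda>t\<in>T. X t \<omega>) (\<Pi>\<^sub>M t\<in>T. borel)))
       (sets (vimage_algebra (space M) Z borel))"

definition path_length :: "(real \<Rightarrow> 'a::metric_space) \<Rightarrow> ennreal" where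
  "path_length g =
     (SUP ts\<in>{ts. sorted ts \<and> set ts \<subseteq> {0..1}}.
        \<Sum>i<length ts - 1. ennreal (dist (g (ts ! i)) (g (ts ! Suc i))))"

(* For a convex body the perimeter is the length of the boundary, traversed once by a closed
   simple path; the length does not depend on the choice of this path. A compact convex set
   without interior is a segment or a point (or empty), and a segment counts twice. *)
definition perim :: "(real^2) set \<Rightarrow> real" where
  "perim K =
     (if interior K = {} then 2 * diameter K
      else (THE L. L \<ge> 0 \<and>
        (\<exists>g. simple_path g \<and> pathfinish g = pathstart g \<and> path_image g = frontier K \<and>
             path_length g = ennreal L)))"

definition X_sigma :: "(real \<Rightarrow> 'w \<Rightarrow> real^2) \<Rightarrow> ('w \<Rightarrow> real^2) \<Rightarrow> real \<Rightarrow> real \<Rightarrow> 'w \<Rightarrow> real^2" where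
  "X_sigma B Z \<sigma> t \<omega> = B t \<omega> + (\<sigma> * t) *\<^sub>R Z \<omega>"

definition K_sigma :: "(real \<Rightarrow> 'w \<Rightarrow> real^2) \<Rightarrow> ('w \<Rightarrow> real^2) \<Rightarrow> real \<Rightarrow> 'w \<Rightarrow> (real^2) set" where
  "K_sigma B Z \<sigma> \<omega> = convex hull ((\<lambda>t. X_sigma B Z \<sigma> t \<omega>) ` {0..1})"

end

theory Submission
  imports Defs "HOL-Complex_Analysis.Contour_Integration"
begin

text \<open>By Cauchy's formula the perimeter of a convex body is half the integral, over all directions,
  of its breadth, so by Tonelli it suffices to find the expected maximum of the one-dimensional
  process \<open>X\<^sub>\<sigma>(t) \<bullet> u\<close> for a unit vector \<open>u\<close>. On a grid of mesh \<open>1/n\<close> this process is a walk with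
  exchangeable Gaussian increments, and Spitzer's identity gives the expected maximum
  \<open>\<Sum>\<^sub>k E[S\<^sub>k\<^sup>+] / k\<close>. Since \<open>S\<^sub>k\<close> is centred normal with variance \<open>t - (1 - \<sigma>\<^sup>2) t\<^sup>2\<close>, \<open>t = k/n\<close>, this is a
  Riemann sum which converges to \<open>1/sqrt (2 * pi)\<close> times the integral of \<open>sqrt (1/t - (1 - \<sigma>\<^sup>2))\<close>
  over \<open>[0, 1]\<close>. Monotone convergence along dyadic grids yields the claim.\<close>

section \<open>Support function and breadth\<close>

text \<open>\<open>perim\<close> is a \<open>THE\<close> over all simple closed parametrisations of
  the frontier, so Cauchy's formula is needed for each of them: level crossings bound the length
  from above, inscribed dyadic polygons from below, and a homeomorphism with the circle supplies one
  parametrisation. Exchangeability comes from a covariance: on the grid the bridge increments have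
  covariance \<open>(if i = j then 1/n else 0) - 1/n^2\<close>, and the common drift adds
  \<open>\<sigma>^2/n^2\<close> to every entry. The characteristic function of the increments thus
  depends on the coefficients \<open>a i\<close> only through their sum and their sum of squares.
  Spitzer's identity uses just the invariance under cyclic rotation of the first \<open>m\<close>
  increments. Characteristic functions also cover variance 0, which occurs for
  \<open>\<sigma> = 0\<close> at time 1. The limiting integrand is unbounded at 0, so the sums are
  compared with the increments of an explicit primitive. The constant: half the breadth has the mean
  of one support function, \<open>1/sqrt (2*pi)\<close> times the integral, and a full turn of
  directions multiplies this by \<open>2*pi\<close>.\<close>

definition dir :: "real \<Rightarrow> real^2" where
  "dir \<theta> = vector [cos \<theta>, sin \<theta>]"

definition support_fun :: "'a::real_inner set \<Rightarrow> 'a \<Rightarrow> real" where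
  "support_fun S e = (SUP x\<in>S. x \<bullet> e)"

text \<open>Unlike the support function it is nonnegative on nonempty bounded sets, so integrals
  over directions can be taken in \<open>ennreal\<close>. Over a full turn it integrates to twice
  the support function, whence the factor 1/2 in Cauchy's formula.\<close>

definition breadth :: "'a::real_inner set \<Rightarrow> 'a \<Rightarrow> real" where
  "breadth S e = support_fun S e + support_fun S (- e)"

definition dyadics :: "nat \<Rightarrow> real set" where
  "dyadics n = (\<lambda>k. real k / 2 ^ n) ` {..2 ^ n}"

lemma inner_dir: "v \<bullet> dir \<theta> = v $ 1 * cos \<theta> + v $ 2 * sin \<theta>"
  by (simp add: dir_def inner_vec_def sum_2)

lemma norm_dir [simp]: "norm (dir \<theta>) = 1"
  by (simp add: norm_eq_sqrt_inner inner_dir, simp add: dir_def power2_eq_square[symmetric])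

lemma bdd_above_inner:
  assumes "bounded (S :: 'a::real_inner set)"
  shows "bdd_above ((\<lambda>x. x \<bullet> e) ` S)"
proof -
  obtain b where b: "\<And>x. x \<in> S \<Longrightarrow> norm x \<le> b"
    using assms bounded_iff by blast
  have "x \<bullet> e \<le> b * norm e" if "x \<in> S" for x
    using norm_cauchy_schwarz[of x e] mult_right_mono[OF b[OF that] norm_ge_zero[of e]] by linarith
  then show ?thesis by (auto intro!: bdd_aboveI)
qed

lemma inner_le_support_fun:
  assumes "bounded S" "x \<in> S"
  shows "x \<bullet> e \<le> support_fun S e"
  unfolding support_fun_def by (rule cSUP_upper[OF assms(2) bdd_above_inner[OF assms(1)]])

lemma support_fun_le:
  assumes "S \<noteq> {}" "\<And>x. x \<in> S \<Longrightarrow> x \<bullet> e \<le> c"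
  shows "support_fun S e \<le> c"
  unfolding support_fun_def by (rule cSUP_least[OF assms])

lemma support_fun_mono:
  assumes "S \<subseteq> T" "S \<noteq> {}" "bounded T"
  shows "support_fun S e \<le> support_fun T e"
  using assms by (intro support_fun_le) (auto intro: inner_le_support_fun)

lemma breadth_mono:
  assumes "S \<subseteq> T" "S \<noteq> {}" "bounded T"
  shows "breadth S e \<le> breadth T e"
  unfolding breadth_def by (intro add_mono support_fun_mono assms)

lemma inner_diff_le_breadth:
  assumes "bounded S" "x \<in> S" "y \<in> S"
  shows "x \<bullet> e - y \<bullet> e \<le> breadth S e"
  using inner_le_support_fun[OF assms(1,2), of e] inner_le_support_fun[OF assms(1,3), of "-e"]
  by (simp add: breadth_def)

lemma breadth_nonneg:
  assumes "bounded S" "S \<noteq> {}"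
  shows "0 \<le> breadth S e"
proof -
  obtain x where "x \<in> S" using assms by auto
  then show ?thesis using inner_diff_le_breadth[OF assms(1), of x x e] by simp
qed

lemma support_fun_attained:
  assumes "compact S" "S \<noteq> {}"
  obtains x where "x \<in> S" "support_fun S e = x \<bullet> e"
proof -
  have "continuous_on S (\<lambda>x. x \<bullet> e)" by (intro continuous_intros)
  then obtain x where x: "x \<in> S" "\<And>y. y \<in> S \<Longrightarrow> y \<bullet> e \<le> x \<bullet> e"
    using continuous_attains_sup[OF assms] by metis
  then have "support_fun S e = x \<bullet> e"
    using assms by (intro antisym support_fun_le inner_le_support_fun compact_imp_bounded) auto
  with x that show thesis by blast
qed

lemma breadth_attained:
  assumes "compact S" "S \<noteq> {}"
  obtains x y where "x \<in> S" "y \<in> S" "breadth S e = x \<bullet> e - y \<bullet> e"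
proof -
  obtain x where "x \<in> S" "support_fun S e = x \<bullet> e" by (rule support_fun_attained[OF assms])
  moreover obtain y where "y \<in> S" "support_fun S (-e) = y \<bullet> (-e)" by (rule support_fun_attained[OF assms])
  ultimately show thesis using that[of x y] by (simp add: breadth_def)
qed

text \<open>A half-space that contains \<open>S\<close> contains its hull. This removes the hull
  from the problem: breadths of \<open>K_sigma\<close> are breadths of the trajectory
  itself.\<close>

lemma support_fun_convex_hull:
  assumes "bounded S" "S \<noteq> {}"
  shows "support_fun (convex hull S) e = support_fun S e"
proof (rule antisym)
  have "convex hull S \<subseteq> {x. e \<bullet> x \<le> support_fun S e}"
    using inner_le_support_fun[OF assms(1)]
    by (intro hull_minimal convex_halfspace_le) (auto simp: inner_commute)
  then show "support_fun (convex hull S) e \<le> support_fun S e"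
    using assms by (intro support_fun_le) (auto simp: inner_commute)
  show "support_fun S e \<le> support_fun (convex hull S) e"
    using assms by (intro support_fun_mono hull_subset bounded_convex_hull)
qed

lemma breadth_convex_hull:
  assumes "bounded S" "S \<noteq> {}"
  shows "breadth (convex hull S) e = breadth S e"
  using assms by (simp add: breadth_def support_fun_convex_hull)

lemma support_fun_segment: "support_fun (closed_segment a b) e = max (a \<bullet> e) (b \<bullet> e)"
proof -
  have "support_fun (closed_segment a b) e = support_fun {a, b} e"
    by (simp add: segment_convex_hull support_fun_convex_hull)
  also have "\<dots> = max (a \<bullet> e) (b \<bullet> e)"
    by (simp add: support_fun_def cSup_eq_Max)
  finally show ?thesis .
qed

lemma breadth_segment: "breadth (closed_segment a b) e = \<bar>(a - b) \<bullet> e\<bar>"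
  by (simp add: breadth_def support_fun_segment inner_diff_left max_def)

section \<open>Dyadic grids and the breadth of a continuous path\<close>

lemma finite_dyadics [simp]: "finite (dyadics n)" 
  and dyadics_nonempty [simp]: "dyadics n \<noteq> {}"
  by (auto simp: dyadics_def)

lemma dyadics_subset: "dyadics n \<subseteq> {0..1}"
proof
  fix x assume "x \<in> dyadics n"
  then obtain k where k: "k \<le> 2 ^ n" "x = real k / 2 ^ n" by (auto simp: dyadics_def)
  have "real k \<le> 2 ^ n" using k(1) by (metis of_nat_le_iff of_nat_numeral of_nat_power)
  then show "x \<in> {0..1}" using k(2) by simp
qed

lemma dyadics_Suc: "dyadics n \<subseteq> dyadics (Suc n)"
proof
  fix x assume "x \<in> dyadics n"
  then obtain k where "k \<le> 2 ^ n" "x = real k / 2 ^ n" by (auto simp: dyadics_def)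
  then have "2 * k \<le> 2 ^ Suc n" "x = real (2 * k) / 2 ^ Suc n" by auto
  then show "x \<in> dyadics (Suc n)" unfolding dyadics_def by blast
qed

lemma dyadics_mono: "m \<le> n \<Longrightarrow> dyadics m \<subseteq> dyadics n"
  by (rule lift_Suc_mono_le[of dyadics, OF dyadics_Suc])

lemma dyadic_approx:
  assumes "t \<in> {0..1}"
  obtains q where "\<And>n. q n \<in> dyadics n" "q \<longlonglongrightarrow> t"
proof
  define q where "q n = real (nat \<lfloor>t * 2 ^ n\<rfloor>) / 2 ^ n" for n
  show "q n \<in> dyadics n" for n
  proof -
    have "\<lfloor>t * 2 ^ n\<rfloor> \<le> \<lfloor>(2::real) ^ n\<rfloor>"
      using assms by (intro floor_mono) (simp add: mult_left_le_one_le)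
    also have "\<lfloor>(2::real) ^ n\<rfloor> = 2 ^ n" by (metis floor_of_int of_int_numeral of_int_power)
    finally show ?thesis unfolding q_def dyadics_def by (intro imageI) (simp add: nat_le_iff)
  qed
  have b: "t - (1/2) ^ n \<le> q n" "q n \<le> t" for n
  proof -
    have "real (nat \<lfloor>t * 2 ^ n\<rfloor>) = of_int \<lfloor>t * 2 ^ n\<rfloor>" using assms by simp
    then have "t * 2 ^ n - 1 \<le> real (nat \<lfloor>t * 2 ^ n\<rfloor>)" "real (nat \<lfloor>t * 2 ^ n\<rfloor>) \<le> t * 2 ^ n"
      by linarith+
    then have "(t * 2 ^ n - 1) / 2 ^ n \<le> q n" "q n \<le> t * 2 ^ n / 2 ^ n"
      unfolding q_def by (intro divide_right_mono; simp)+
    then show "t - (1/2) ^ n \<le> q n" "q n \<le> t"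
      by (simp_all add: diff_divide_distrib power_one_over)
  qed
  have "(\<lambda>n. t - (1/2) ^ n) \<longlonglongrightarrow> t - 0"
    by (intro tendsto_intros LIMSEQ_power_zero) auto
  then show "q \<longlonglongrightarrow> t"
    using b by (intro tendsto_sandwich[of "\<lambda>n. t - (1/2) ^ n" q sequentially "\<lambda>_. t" t]) auto
qed

text \<open>The grids are nested, hence the monotonicity. By compactness the breadth is attained at
  two times; dyadic times approach both, and the difference of the path values there is a lower
  bound for the breadth at stage \<open>n\<close> that converges to the full breadth.\<close>

lemma breadth_dyadic_LIMSEQ:
  fixes p :: "real \<Rightarrow> 'a::real_inner"
  assumes p: "continuous_on {0..1} p"
  shows "incseq (\<lambda>n. breadth (p ` dyadics n) e)"
    and "(\<lambda>n. breadth (p ` dyadics n) e) \<longlonglongrightarrow> breadth (p ` {0..1}) e"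
proof -
  have bd: "bounded (p ` {0..1})"
    by (intro compact_imp_bounded compact_continuous_image p) simp
  have bd': "bounded (p ` dyadics n)" for n by (intro finite_imp_bounded) simp
  show "incseq (\<lambda>n. breadth (p ` dyadics n) e)"
    by (intro monoI breadth_mono image_mono dyadics_mono bd') auto
  have ub: "breadth (p ` dyadics n) e \<le> breadth (p ` {0..1}) e" for n
    by (intro breadth_mono image_mono dyadics_subset bd) auto
  obtain x y where xy: "x \<in> p ` {0..1}" "y \<in> p ` {0..1}" "breadth (p ` {0..1}) e = x \<bullet> e - y \<bullet> e"
    by (rule breadth_attained[of "p ` {0..1}"]) (auto intro: compact_continuous_image p)
  then obtain s t where st: "s \<in> {0..1}" "t \<in> {0..1}" "x = p s" "y = p t" by auto
  obtain q where q: "\<And>n. q n \<in> dyadics n" "q \<longlonglongrightarrow> s" using dyadic_approx[OF st(1)] by blast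
  obtain r where r: "\<And>n. r n \<in> dyadics n" "r \<longlonglongrightarrow> t" using dyadic_approx[OF st(2)] by blast
  have qr: "q n \<in> {0..1}" "r n \<in> {0..1}" for n using q(1) r(1) dyadics_subset by blast+
  have "(\<lambda>n. p (q n)) \<longlonglongrightarrow> p s" "(\<lambda>n. p (r n)) \<longlonglongrightarrow> p t"
    using continuous_on_tendsto_compose[OF p q(2) st(1)] continuous_on_tendsto_compose[OF p r(2) st(2)] qr
    by auto
  then have l: "(\<lambda>n. p (q n) \<bullet> e - p (r n) \<bullet> e) \<longlonglongrightarrow> breadth (p ` {0..1}) e"
    unfolding xy(3) st by (intro tendsto_intros)
  show "(\<lambda>n. breadth (p ` dyadics n) e) \<longlonglongrightarrow> breadth (p ` {0..1}) e"
    by (rule tendsto_sandwich[OF _ _ l tendsto_const])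
       (auto intro!: always_eventually inner_diff_le_breadth bd' ub imageI q r)
qed

section \<open>Cauchy's formula for the perimeter\<close>

text \<open>For nonzero \<open>v\<close>, the vector \<open>dir \<psi>\<close> is a unit normal to
  \<open>v\<close> in the closed upper half-plane. The range of \<open>\<psi>\<close> puts both
  zeros \<open>\<psi>\<close> and \<open>\<psi> + pi\<close> of the sine into
  \<open>[0, 2*pi]\<close>, which yields three intervals of constant sign for the
  integration.\<close>

lemma polar_normal:
  fixes v :: "real^2"
  obtains \<psi> where "0 \<le> \<psi>" "\<psi> \<le> pi" "\<And>\<theta>. \<bar>v \<bullet> dir \<theta>\<bar> = norm v * \<bar>sin (\<theta> - \<psi>)\<bar>"
proof -
  define r where "r = norm v"
  have r2: "(v$1)\<^sup>2 + (v$2)\<^sup>2 = r\<^sup>2"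
    by (simp add: r_def norm_eq_sqrt_inner inner_vec_def sum_2 power2_eq_square)
  show thesis
  proof (cases "v = 0")
    case True
    then show thesis using that[of 0] by simp
  next
    case False
    then have r: "r > 0" by (simp add: r_def)
    \<comment> \<open>The sign turns the normal \<open>\<epsilon> (v$2, - v$1) / r\<close> into the
      upper half-plane; the absolute value hides it afterwards.\<close>
    define \<epsilon> :: real where "\<epsilon> = (if v$1 \<le> 0 then 1 else -1)"
    have e: "\<epsilon>\<^sup>2 = 1" "\<bar>\<epsilon>\<bar> = 1" "0 \<le> - \<epsilon> * v$1" by (auto simp: \<epsilon>_def)
    have "(\<epsilon> * v$2 / r)\<^sup>2 + (- \<epsilon> * v$1 / r)\<^sup>2 = 1"
      using r r2 e(1) by (simp add: power_divide power_mult_distrib add_divide_distrib[symmetric] add.commute)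
    then obtain \<psi> where p: "0 \<le> \<psi>" "\<psi> \<le> pi" "\<epsilon> * v$2 / r = cos \<psi>" "- \<epsilon> * v$1 / r = sin \<psi>"
      using sincos_total_pi[of "- \<epsilon> * v$1 / r" "\<epsilon> * v$2 / r"] r e(3) by (auto simp: divide_nonpos_pos)
    have "\<bar>v \<bullet> dir \<theta>\<bar> = norm v * \<bar>sin (\<theta> - \<psi>)\<bar>" for \<theta>
    proof -
      have "\<epsilon> * v$2 = r * cos \<psi>" "\<epsilon> * v$1 = - r * sin \<psi>" using p r by (auto simp: field_simps)
      moreover have "\<epsilon> * (v \<bullet> dir \<theta>) = (\<epsilon> * v$1) * cos \<theta> + (\<epsilon> * v$2) * sin \<theta>"
        by (simp add: inner_dir algebra_simps)
      ultimately have "\<epsilon> * (v \<bullet> dir \<theta>) = r * sin (\<theta> - \<psi>)"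
        by (simp add: sin_diff algebra_simps)
      then have "\<bar>\<epsilon>\<bar> * \<bar>v \<bullet> dir \<theta>\<bar> = r * \<bar>sin (\<theta> - \<psi>)\<bar>" using r by (simp flip: abs_mult) (simp add: abs_mult)
      then show ?thesis by (simp add: e r_def)
    qed
    with p that show thesis by blast
  qed
qed

text \<open>The integral of \<open>\<bar>sin\<bar>\<close> over a full period is 4, whence the
  division by 4. Every length is thereby an integral of projected lengths, which reduces curve
  length to the variation of scalar functions.\<close>

lemma nn_integral_abs_inner_dir:
  "(\<integral>\<^sup>+\<theta>\<in>{0..2*pi}. ennreal (\<bar>v \<bullet> dir \<theta>\<bar> / 4) \<partial>lborel) = ennreal (norm v)"
proof -
  obtain \<psi> where p: "0 \<le> \<psi>" "\<psi> \<le> pi" "\<And>\<theta>. \<bar>v \<bullet> dir \<theta>\<bar> = norm v * \<bar>sin (\<theta> - \<psi>)\<bar>"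
    by (rule polar_normal) blast
  have d: "((\<lambda>\<theta>. cos (\<theta> - \<psi>)) has_vector_derivative - sin (x - \<psi>)) (at x within S)" for x S
    unfolding has_real_derivative_iff_has_vector_derivative[symmetric]
    by (auto intro!: derivative_eq_intros)
  have d': "((\<lambda>\<theta>. - cos (\<theta> - \<psi>)) has_vector_derivative sin (x - \<psi>)) (at x within S)" for x S
    unfolding has_real_derivative_iff_has_vector_derivative[symmetric]
    by (auto intro!: derivative_eq_intros)
  have "((\<lambda>\<theta>. \<bar>sin (\<theta> - \<psi>)\<bar>) has_integral (1 - cos \<psi>)) {0..\<psi>}"
  proof (rule has_integral_eq)
    show "((\<lambda>\<theta>. - sin (\<theta> - \<psi>)) has_integral (1 - cos \<psi>)) {0..\<psi>}"
      using fundamental_theorem_of_calculus[of 0 \<psi> "\<lambda>\<theta>. cos (\<theta> - \<psi>)" "\<lambda>\<theta>. - sin (\<theta> - \<psi>)", OF _ d] p by simp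
    fix x assume "x \<in> {0..\<psi>}"
    then have "0 \<le> \<psi> - x" "\<psi> - x \<le> pi" using p by auto
    then have "0 \<le> sin (\<psi> - x)" by (rule sin_ge_zero)
    moreover have "sin (x - \<psi>) = - sin (\<psi> - x)" by (simp flip: sin_minus)
    ultimately show "- sin (x - \<psi>) = \<bar>sin (x - \<psi>)\<bar>" by simp
  qed
  moreover have "((\<lambda>\<theta>. \<bar>sin (\<theta> - \<psi>)\<bar>) has_integral 2) {\<psi>..\<psi> + pi}"
  proof (rule has_integral_eq)
    show "((\<lambda>\<theta>. sin (\<theta> - \<psi>)) has_integral 2) {\<psi>..\<psi>+pi}"
      using fundamental_theorem_of_calculus[of \<psi> "\<psi>+pi" "\<lambda>\<theta>. - cos (\<theta> - \<psi>)" "\<lambda>\<theta>. sin (\<theta> - \<psi>)", OF _ d'] p by simp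
    fix x assume "x \<in> {\<psi>..\<psi>+pi}"
    then have "0 \<le> x - \<psi>" "x - \<psi> \<le> pi" using p by auto
    then show "sin (x - \<psi>) = \<bar>sin (x - \<psi>)\<bar>" using sin_ge_zero by simp
  qed
  ultimately have "((\<lambda>\<theta>. \<bar>sin (\<theta> - \<psi>)\<bar>) has_integral (1 - cos \<psi> + 2)) {0..\<psi> + pi}"
    using p by (intro has_integral_combine[of 0 \<psi>]) auto
  moreover have "((\<lambda>\<theta>. \<bar>sin (\<theta> - \<psi>)\<bar>) has_integral (1 + cos \<psi>)) {\<psi> + pi..2*pi}"
  proof (rule has_integral_eq)
    have "cos (2*pi - \<psi>) = cos \<psi>" by (simp add: cos_diff)
    then show "((\<lambda>\<theta>. - sin (\<theta> - \<psi>)) has_integral (1 + cos \<psi>)) {\<psi> + pi..2*pi}"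
      using fundamental_theorem_of_calculus[of "\<psi>+pi" "2*pi" "\<lambda>\<theta>. cos (\<theta> - \<psi>)" "\<lambda>\<theta>. - sin (\<theta> - \<psi>)", OF _ d] p by (simp add: add.commute)
    fix x assume "x \<in> {\<psi>+pi..2*pi}"
    then have "0 \<le> x - \<psi> - pi" "x - \<psi> - pi \<le> pi" using p by auto
    then have "0 \<le> sin (x - \<psi> - pi)" by (rule sin_ge_zero)
    also have "sin (x - \<psi> - pi) = - sin (x - \<psi>)" by (simp add: sin_diff)
    finally show "- sin (x - \<psi>) = \<bar>sin (x - \<psi>)\<bar>" by simp
  qed
  ultimately have "((\<lambda>\<theta>. \<bar>sin (\<theta> - \<psi>)\<bar>) has_integral (1 - cos \<psi> + 2 + (1 + cos \<psi>))) {0..2*pi}"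
    using p by (elim has_integral_combine[rotated 2]) auto
  then have "((\<lambda>\<theta>. \<bar>v \<bullet> dir \<theta>\<bar> / 4) has_integral norm v) {0..2*pi}"
    unfolding p(3) using has_integral_mult_right[of "\<lambda>\<theta>. \<bar>sin (\<theta> - \<psi>)\<bar>" 4 "{0..2*pi}" "norm v / 4"]
    by simp
  then show ?thesis
    by (intro nn_integral_has_integral_lebesgue') auto
qed

section \<open>Level lines of a convex body and the variation along its frontier\<close>

lemma dir_decomp:
  assumes "w \<bullet> dir \<theta> = 0"
  shows "w = (w \<bullet> vector [- sin \<theta>, cos \<theta>]) *\<^sub>R vector [- sin \<theta>, cos \<theta>]"
proof -
  define c s where "c = cos \<theta>" "s = sin \<theta>"
  have cs: "c * c + s * s = 1" by (simp add: c_s_def)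
  have 0: "w$1 * c + w$2 * s = 0" using assms by (simp add: inner_dir c_s_def)
  have "w$1 = - s * (w$2 * c - w$1 * s)" "w$2 = c * (w$2 * c - w$1 * s)"
    using 0 cs by algebra+
  then show ?thesis
    by (simp add: vec_eq_iff forall_2 inner_vec_def sum_2 c_s_def) (simp add: algebra_simps)
qed

text \<open>Measure positions on the level line by the signed distance \<open>\<alpha>\<close> from
  the interior point \<open>z\<close>. Of two frontier points on the same side of \<open>z\<close>,
  the nearer would lie in the open segment from \<open>z\<close> to the farther and so be interior.
  Hence the sign of \<open>\<alpha>\<close> is injective on \<open>T\<close>. The interior point
  excludes supporting lines, which may contain a whole edge.\<close>

lemma card_frontier_level_le_2:
  fixes K :: "(real^2) set"
  assumes K: "convex K" "closed K" and z: "z \<in> interior K"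
    and T: "T \<subseteq> frontier K" "\<And>x. x \<in> T \<Longrightarrow> x \<bullet> dir \<theta> = z \<bullet> dir \<theta>"
  shows "card T \<le> 2"
proof -
  define u :: "real^2" where "u = vector [- sin \<theta>, cos \<theta>]"
  define \<alpha> where "\<alpha> x = (x - z) \<bullet> u" for x
  have x: "x - z = \<alpha> x *\<^sub>R u" if "x \<in> T" for x
    unfolding \<alpha>_def u_def by (rule dir_decomp) (simp add: inner_diff_left T(2) that)
  have zT: "z \<notin> T" using T(1) z by (auto simp: frontier_def)
  have \<alpha>0: "\<alpha> x \<noteq> 0" if "x \<in> T" for x using x[OF that] zT that by auto
  have seg: "\<not> (\<bar>\<alpha> x\<bar> < \<bar>\<alpha> y\<bar>)" if xy: "x \<in> T" "y \<in> T" and sg: "sgn (\<alpha> x) = sgn (\<alpha> y)" for x y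
  proof
    assume less: "\<bar>\<alpha> x\<bar> < \<bar>\<alpha> y\<bar>"
    define r where "r = \<alpha> x / \<alpha> y"
    have r: "0 < r" "r < 1" using sg less \<alpha>0[OF xy(1)] \<alpha>0[OF xy(2)]
      by (auto simp: r_def sgn_if field_simps split: if_splits)
    have "x - z = r *\<^sub>R (y - z)"
      using x[OF xy(1)] x[OF xy(2)] \<alpha>0[OF xy(2)] by (simp add: r_def)
    then have "x = (1 - r) *\<^sub>R z + r *\<^sub>R y" by (simp add: algebra_simps)
    moreover have "z \<noteq> y" using zT xy by auto
    ultimately have "x \<in> open_segment z y" using r by (auto simp: in_segment)
    also have "open_segment z y \<subseteq> interior K"
      using xy(2) T(1) K z by (intro in_interior_closure_convex_segment) (auto simp: frontier_def)
    finally show False using xy(1) T(1) by (auto simp: frontier_def)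
  qed
  have "inj_on (\<lambda>x. sgn (\<alpha> x)) T"
  proof (rule inj_onI)
    fix x y assume xy: "x \<in> T" "y \<in> T" "sgn (\<alpha> x) = sgn (\<alpha> y)"
    have "\<bar>\<alpha> x\<bar> = \<bar>\<alpha> y\<bar>" using seg[OF xy] seg[OF xy(2,1)] xy(3) by linarith
    then have "\<alpha> x = \<alpha> y" using xy(3) by (metis mult_sgn_abs)
    then have "x - z = y - z" using x xy by simp
    then show "x = y" by simp
  qed
  moreover have "(\<lambda>x. sgn (\<alpha> x)) ` T \<subseteq> {-1, 1}" using \<alpha>0 by (auto simp: sgn_if)
  ultimately have "card T \<le> card {-1, 1::real}" by (intro card_inj_on_le) auto
  then show ?thesis by simp
qed

text \<open>A convex set with nonempty interior lies in the closure of that interior, so an open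
  half-space that meets \<open>K\<close> meets \<open>interior K\<close>; connectedness of the
  interior then gives the intermediate value.\<close>

lemma interior_level:
  fixes K :: "'a::euclidean_space set"
  assumes K: "convex K" "interior K \<noteq> {}" and pq: "p \<in> K" "q \<in> K" "p \<bullet> e < c" "c < q \<bullet> e"
  obtains z where "z \<in> interior K" "z \<bullet> e = c"
proof -
  have cl: "K \<subseteq> closure (interior K)" using K by (metis closure_subset convex_closure_interior)
  have "open {x. e \<bullet> x < c}" by (rule open_halfspace_lt)
  moreover have "{x. e \<bullet> x < c} \<inter> closure (interior K) \<noteq> {}" using cl pq by (auto simp: inner_commute)
  ultimately have "{x. e \<bullet> x < c} \<inter> interior K \<noteq> {}" by (simp add: open_Int_closure_eq_empty)
  then obtain p' where p': "p' \<in> interior K" "e \<bullet> p' < c" by auto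
  have "open {x. c < e \<bullet> x}" by (rule open_halfspace_gt)
  moreover have "{x. c < e \<bullet> x} \<inter> closure (interior K) \<noteq> {}" using cl pq by (auto simp: inner_commute)
  ultimately have "{x. c < e \<bullet> x} \<inter> interior K \<noteq> {}" by (simp add: open_Int_closure_eq_empty)
  then obtain q' where q': "q' \<in> interior K" "c < e \<bullet> q'" by auto
  have "connected (interior K)" using K(1) by (simp add: convex_interior convex_connected)
  then obtain z where "z \<in> interior K" "e \<bullet> z = c"
    using connected_ivt_hyperplane[of "interior K" p' q' e c] p' q' by auto
  then show thesis using that by (simp add: inner_commute)
qed

text \<open>Banach indicatrix: the variation is the integral over all levels of the number of crossings,
  and a line through the interior meets the frontier in at most two points.\<close>

lemma inner_variation_le:
  fixes K :: "(real^2) set"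
  assumes K: "convex K" "compact K" "interior K \<noteq> {}"
    and g: "simple_path g" "path_image g = frontier K"
    and ts: "sorted ts" "set ts \<subseteq> {0..1}"
  shows "(\<Sum>i<length ts - 1. \<bar>(g (ts ! i) - g (ts ! Suc i)) \<bullet> dir \<theta>\<bar>) \<le> 2 * breadth K (dir \<theta>)"
proof -
  let ?e = "dir \<theta>"
  define n where "n = length ts - 1"
  define f where "f t = g t \<bullet> ?e" for t
  \<comment> \<open>Open intervals: a level in \<open>I i\<close> is attained strictly between the
    two parameters, so crossings that belong to different \<open>i\<close> have different parameters
    even though neighbouring parameter intervals share an end point.\<close>
  define I where "I i = {min (f (ts ! i)) (f (ts ! Suc i)) <..< max (f (ts ! i)) (f (ts ! Suc i))}" for i
  define m where "m = - support_fun K (- ?e)"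
  define M where "M = support_fun K ?e"
  have bK: "bounded K" by (rule compact_imp_bounded[OF K(2)])
  have clK: "closed K" by (rule compact_imp_closed[OF K(2)])
  have gK: "g t \<in> K" "g t \<in> frontier K" if "t \<in> {0..1}" for t
  proof -
    show "g t \<in> frontier K" using that g(2) by (auto simp: path_image_def)
    then show "g t \<in> K" using clK by (auto simp: frontier_def)
  qed
  have mM: "m \<le> f t" "f t \<le> M" if "t \<in> {0..1}" for t
    using inner_le_support_fun[OF bK gK(1)[OF that], of ?e] inner_le_support_fun[OF bK gK(1)[OF that], of "- ?e"]
    by (auto simp: m_def M_def f_def)
  \<comment> \<open>The condition \<open>n \<noteq> 0\<close> excludes the empty list, for which the
    truncated \<open>length ts - 1\<close> is 0 as well.\<close>
  have tsn: "ts ! i \<in> {0..1}" if "i \<le> n" "n \<noteq> 0" for i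
    using that ts(2) nth_mem[of i ts] by (fastforce simp: n_def)
  have cont: "continuous_on {0..1} f" unfolding f_def
    using simple_path_imp_path[OF g(1)] by (intro continuous_intros) (simp add: path_def)
  have count: "card {i. i < n \<and> c \<in> I i} \<le> 2" for c
  proof (cases "{i. i < n \<and> c \<in> I i} = {}")
    case False
    then obtain j where j: "j < n" "c \<in> I j" by auto
    define p q where "p = (if f (ts ! j) < f (ts ! Suc j) then ts ! j else ts ! Suc j)"
      and "q = (if f (ts ! j) < f (ts ! Suc j) then ts ! Suc j else ts ! j)"
    have pq: "p \<in> {0..1}" "q \<in> {0..1}" "f p < c" "c < f q"
      using j tsn[of j] tsn[of "Suc j"] by (auto simp: p_def q_def I_def)
    obtain z where z: "z \<in> interior K" "z \<bullet> ?e = c"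
      using interior_level[OF K(1,3) gK(1)[OF pq(1)] gK(1)[OF pq(2)], of ?e c] pq(3,4) by (auto simp: f_def)
    have ex: "\<exists>s. ts ! i < s \<and> s < ts ! Suc i \<and> f s = c" if "i < n" "c \<in> I i" for i
    proof -
      have le: "ts ! i \<le> ts ! Suc i" using ts(1) that(1) by (intro sorted_nth_mono) (auto simp: n_def)
      have 01: "ts ! i \<in> {0..1}" "ts ! Suc i \<in> {0..1}" using tsn that by auto
      have ct: "continuous_on {ts ! i .. ts ! Suc i} f" 
        using 01 by (intro continuous_on_subset[OF cont]) auto
      have "\<exists>s. ts ! i \<le> s \<and> s \<le> ts ! Suc i \<and> f s = c"
        using IVT'[of f "ts ! i" c "ts ! Suc i"] IVT2'[of f "ts ! Suc i" c "ts ! i"] le ct that(2)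
        by (auto simp: I_def min_def max_def split: if_splits)
      then obtain s where s: "ts ! i \<le> s" "s \<le> ts ! Suc i" "f s = c" by auto
      moreover have "s \<noteq> ts ! i" "s \<noteq> ts ! Suc i" using s(3) that(2) by (auto simp: I_def)
      ultimately show ?thesis by (intro exI[of _ s]) auto
    qed
    then obtain s where s: "\<And>i. i < n \<Longrightarrow> c \<in> I i \<Longrightarrow> ts ! i < s i \<and> s i < ts ! Suc i \<and> f (s i) = c"
      by metis
    let ?I = "{i. i < n \<and> c \<in> I i}"
    \<comment> \<open>Strictness matters: \<open>loop_free\<close> permits the values of the path at
      0 and 1 to coincide.\<close>
    have s01: "0 < s i \<and> s i < 1" if "i \<in> ?I" for i
      using s[of i] tsn[of i] tsn[of "Suc i"] that by auto
    have s_less: "s i < s j" if "i \<in> ?I" "j \<in> ?I" "i < j" for i j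
    proof -
      have "ts ! Suc i \<le> ts ! j" using ts(1) that by (intro sorted_nth_mono) (auto simp: n_def)
      then show ?thesis using s[of i] s[of j] that by auto
    qed
    have "inj_on (g \<circ> s) ?I"
    proof (rule inj_onI)
      fix i j assume ij: "i \<in> ?I" "j \<in> ?I" "(g \<circ> s) i = (g \<circ> s) j"
      have "s i = s j"
        using ij(3) s01[OF ij(1)] s01[OF ij(2)] g(1)
        unfolding simple_path_def loop_free_def by fastforce
      then show "i = j" using s_less[OF ij(1,2)] s_less[OF ij(2,1)] by (cases i j rule: linorder_cases) auto
    qed
    then have "card ?I = card ((g \<circ> s) ` ?I)" by (rule card_image[symmetric])
    also have "\<dots> \<le> 2"
    proof (rule card_frontier_level_le_2[OF K(1) clK z(1)])
      show "(g \<circ> s) ` ?I \<subseteq> frontier K" using gK(2) s01 by fastforce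
      show "x \<bullet> ?e = z \<bullet> ?e" if "x \<in> (g \<circ> s) ` ?I" for x
        using that s z(2) by (auto simp: f_def)
    qed
    finally show ?thesis .
  next
    case True
    then show ?thesis by (metis card.empty zero_le)
  qed
  have sub: "I i \<subseteq> {m..M}" if "i < n" for i
    using mM[OF tsn[of i]] mM[OF tsn[of "Suc i"]] that by (auto simp: I_def)
  have "emeasure lborel (I i) = ennreal \<bar>f (ts ! i) - f (ts ! Suc i)\<bar>" for i
    by (simp add: I_def max_def min_def)
  then have "ennreal (\<Sum>i<n. \<bar>f (ts ! i) - f (ts ! Suc i)\<bar>) = (\<Sum>i<n. emeasure lborel (I i))"
    by simp
  also have "\<dots> = (\<Sum>i<n. \<integral>\<^sup>+c. indicator (I i) c \<partial>lborel)" by (simp add: I_def)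
  also have "\<dots> = (\<integral>\<^sup>+c. (\<Sum>i<n. indicator (I i) c) \<partial>lborel)"
    by (rule nn_integral_sum[symmetric]) (simp add: I_def)
  also have "\<dots> \<le> (\<integral>\<^sup>+c. 2 * indicator {m..M} c \<partial>lborel)"
  proof (rule nn_integral_mono)
    fix c
    have eq: "(\<Sum>i<n. indicator (I i) c :: ennreal) = of_nat (card {i. i < n \<and> c \<in> I i})"
      by (simp add: indicator_def sum.If_cases lessThan_def Collect_conj_eq[symmetric])
    show "(\<Sum>i<n. indicator (I i) c :: ennreal) \<le> 2 * indicator {m..M} c"
    proof (cases "c \<in> {m..M}")
      case True
      have "of_nat (card {i. i < n \<and> c \<in> I i}) \<le> (of_nat 2 :: ennreal)" using count[of c] by (rule of_nat_mono)
      then show ?thesis using True by (simp add: eq)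
    next
      case False
      then have "(\<Sum>i<n. indicator (I i) c :: ennreal) = 0" using sub by (intro sum.neutral) (fastforce simp: indicator_def)
      then show ?thesis by simp
    qed
  qed
  also have "\<dots> = 2 * emeasure lborel {m..M}" by (simp add: nn_integral_cmult)
  also have "\<dots> = ennreal (2 * breadth K ?e)"
  proof -
    have "breadth K ?e = M - m" by (simp add: breadth_def M_def m_def)
    moreover have "0 \<le> breadth K ?e" using K(3) interior_subset by (intro breadth_nonneg bK) auto
    ultimately show ?thesis by (simp add: ennreal_mult del: right_diff_distrib right_diff_distrib_numeral)
  qed
  finally show ?thesis
    using K(3) interior_subset[of K] breadth_nonneg[OF bK, of ?e]
    by (subst (asm) ennreal_le_iff) (auto simp: f_def n_def inner_diff_left)
qed

text \<open>A closed walk that visits two values must travel from one to the other and back again.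
  In the proof it is cut at the two indices, and the outer pieces are joined through
  \<open>f 0 = f n\<close>.\<close>

lemma closed_variation_ge:
  fixes f :: "nat \<Rightarrow> real"
  assumes "f 0 = f n" "p \<le> n" "q \<le> n"
  shows "2 * (f p - f q) \<le> (\<Sum>i<n. \<bar>f i - f (Suc i)\<bar>)"
proof -
  have tri: "\<bar>f b - f a\<bar> \<le> (\<Sum>i=a..<b. \<bar>f i - f (Suc i)\<bar>)" if "a \<le> b" for a b
    using that
  proof (induction b rule: dec_induct)
    case (step b)
    then show ?case by simp
  qed simp
  have *: "2 * \<bar>f b - f a\<bar> \<le> (\<Sum>i<n. \<bar>f i - f (Suc i)\<bar>)" if "a \<le> b" "b \<le> n" for a b
  proof -
    have "(\<Sum>i=0..<n. \<bar>f i - f (Suc i)\<bar>) =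
      (\<Sum>i=0..<a. \<bar>f i - f (Suc i)\<bar>) + (\<Sum>i=a..<b. \<bar>f i - f (Suc i)\<bar>) + (\<Sum>i=b..<n. \<bar>f i - f (Suc i)\<bar>)"
      using that by (simp add: sum.atLeastLessThan_concat)
    moreover have "2 * \<bar>f b - f a\<bar> \<le> \<bar>f a - f 0\<bar> + \<bar>f b - f a\<bar> + \<bar>f n - f b\<bar>"
      using assms(1) by (smt (verit))
    ultimately show ?thesis
      using tri[of 0 a] tri[of a b] tri[of b n] that by (simp add: atLeast0LessThan)
  qed
  show ?thesis
  proof -
    have "2 * (f p - f q) \<le> 2 * \<bar>f p - f q\<bar>" by (intro mult_left_mono abs_ge_self) simp
    also have "\<dots> \<le> (\<Sum>i<n. \<bar>f i - f (Suc i)\<bar>)"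
      using *[of p q] *[of q p] assms by (cases "p \<le> q") (auto simp: abs_minus_commute)
    finally show ?thesis .
  qed
qed

text \<open>The length of an inscribed polygon is the integral over directions of a quarter of its
  projected variation. That variation is at most twice the breadth of \<open>K\<close> by
  \<open>inner_variation_le\<close>. For dyadic vertices it is at least twice their breadth by
  \<open>closed_variation_ge\<close>, and this increases to the breadth of \<open>K\<close>, because
  \<open>K\<close> is the hull of its frontier. The right-hand side does not involve
  \<open>g\<close>: all parametrisations have the same length.\<close>

lemma path_length_frontier:
  fixes K :: "(real^2) set"
  assumes K: "convex K" "compact K" "interior K \<noteq> {}"
    and g: "simple_path g" "path_image g = frontier K" "pathfinish g = pathstart g"
  shows "path_length g = (\<integral>\<^sup>+\<theta>\<in>{0..2*pi}. ennreal (breadth K (dir \<theta>) / 2) \<partial>lborel)"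
proof (rule antisym)
  have bK: "bounded K" by (rule compact_imp_bounded[OF K(2)])
  have Kne: "K \<noteq> {}" using K(3) interior_subset by auto
  have len: "(\<Sum>i<n. ennreal (dist (g (x i)) (g (x (Suc i))))) =
     (\<integral>\<^sup>+\<theta>\<in>{0..2*pi}. ennreal ((\<Sum>i<n. \<bar>(g (x i) - g (x (Suc i))) \<bullet> dir \<theta>\<bar>) / 4) \<partial>lborel)" for n x
  proof -
    have "(\<Sum>i<n. ennreal (dist (g (x i)) (g (x (Suc i))))) =
      (\<Sum>i<n. \<integral>\<^sup>+\<theta>\<in>{0..2*pi}. ennreal (\<bar>(g (x i) - g (x (Suc i))) \<bullet> dir \<theta>\<bar> / 4) \<partial>lborel)"
      by (simp add: nn_integral_abs_inner_dir dist_norm)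
    also have "\<dots> = (\<integral>\<^sup>+\<theta>. (\<Sum>i<n. ennreal (\<bar>(g (x i) - g (x (Suc i))) \<bullet> dir \<theta>\<bar> / 4) * indicator {0..2*pi} \<theta>) \<partial>lborel)"
      by (rule nn_integral_sum[symmetric]) (simp add: inner_dir)
    also have "\<dots> = (\<integral>\<^sup>+\<theta>\<in>{0..2*pi}. ennreal ((\<Sum>i<n. \<bar>(g (x i) - g (x (Suc i))) \<bullet> dir \<theta>\<bar>) / 4) \<partial>lborel)"
      by (simp add: sum_distrib_right[symmetric] sum_divide_distrib)
    finally show ?thesis .
  qed
  show "path_length g \<le> (\<integral>\<^sup>+\<theta>\<in>{0..2*pi}. ennreal (breadth K (dir \<theta>) / 2) \<partial>lborel)"
    unfolding path_length_def
  proof (rule SUP_least, clarify)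
    fix ts :: "real list" assume ts: "sorted ts" "set ts \<subseteq> {0..1}"
    show "(\<Sum>i<length ts - 1. ennreal (dist (g (ts ! i)) (g (ts ! Suc i))))
       \<le> (\<integral>\<^sup>+\<theta>\<in>{0..2*pi}. ennreal (breadth K (dir \<theta>) / 2) \<partial>lborel)"
      unfolding len
      using inner_variation_le[OF K g(1,2) ts]
      by (intro nn_integral_mono mult_right_mono ennreal_leI) (auto simp: mult.commute)
  qed
  have gc: "continuous_on {0..1} g" using g(1) by (simp add: simple_path_def path_def)
  have img: "g ` {0..1} = frontier K" using g(2) by (simp add: path_image_def)
  have br: "breadth (frontier K) e = breadth K e" for e
  proof -
    have "bounded (frontier K)" using frontier_subset_compact[OF K(2)] bK by (rule bounded_subset[rotated])
    moreover have "frontier K \<noteq> {}" using Krein_Milman_frontier[OF K(1,2)] Kne by (metis convex_hull_empty)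
    ultimately show ?thesis using breadth_convex_hull[of "frontier K" e] Krein_Milman_frontier[OF K(1,2)] by metis
  qed
  define b where "b n \<theta> = ennreal (breadth (g ` dyadics n) (dir \<theta>) / 2) * indicator {0..2*pi} \<theta>" for n \<theta>
  have "(\<integral>\<^sup>+\<theta>\<in>{0..2*pi}. ennreal (breadth K (dir \<theta>) / 2) \<partial>lborel) = (\<integral>\<^sup>+\<theta>. (SUP n. b n \<theta>) \<partial>lborel)"
  proof (rule nn_integral_cong)
    fix \<theta>
    have inc: "incseq (\<lambda>n. b n \<theta>)"
      using breadth_dyadic_LIMSEQ(1)[OF gc, of "dir \<theta>"]
      by (auto intro!: mult_right_mono ennreal_leI simp: mono_def b_def)
    have "(\<lambda>n. b n \<theta>) \<longlonglongrightarrow> ennreal (breadth (g ` {0..1}) (dir \<theta>) / 2) * indicator {0..2*pi} \<theta>"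
      unfolding b_def using breadth_dyadic_LIMSEQ(2)[OF gc, of "dir \<theta>"]
      by (cases "\<theta> \<in> {0..2*pi}") (auto intro!: tendsto_intros)
    then show "ennreal (breadth K (dir \<theta>) / 2) * indicator {0..2*pi} \<theta> = (SUP n. b n \<theta>)"
      using LIMSEQ_unique[OF LIMSEQ_SUP[OF inc]] by (simp add: img br)
  qed
  also have "\<dots> = (SUP n. \<integral>\<^sup>+\<theta>. b n \<theta> \<partial>lborel)"
  proof (rule nn_integral_monotone_convergence_SUP)
    show "incseq b"
      using breadth_dyadic_LIMSEQ(1)[OF gc]
      by (auto intro!: mult_right_mono ennreal_leI simp: mono_def b_def le_fun_def)
    show "b n \<in> borel_measurable lborel" for n
      unfolding b_def breadth_def support_fun_def by (simp add: cSup_eq_Max inner_dir image_image)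
  qed
  also have "\<dots> \<le> path_length g"
  proof (rule SUP_least)
    fix n
    define x where "x k = real k / 2 ^ n" for k
    define ts where "ts = map x [0..<2 ^ n + 1]"
    have x01: "x 0 = 0" "x (2 ^ n) = 1" by (simp_all add: x_def)
    have dy: "dyadics n = x ` {..2 ^ n}" by (simp add: dyadics_def x_def image_def)
    have ts: "sorted ts" "set ts \<subseteq> {0..1}"
    proof -
      show "sorted ts" unfolding ts_def x_def by (simp add: sorted_map divide_right_mono sorted_wrt_iff_nth_less del: upt_Suc)
      have "set ts = dyadics n" unfolding ts_def dy set_map set_upt by (rule arg_cong[of _ _ "image x"]) auto
      then show "set ts \<subseteq> {0..1}" using dyadics_subset by simp
    qed
    have "(\<integral>\<^sup>+\<theta>. b n \<theta> \<partial>lborel) \<le> (\<integral>\<^sup>+\<theta>\<in>{0..2*pi}. ennreal ((\<Sum>i<2^n. \<bar>(g (x i) - g (x (Suc i))) \<bullet> dir \<theta>\<bar>) / 4) \<partial>lborel)"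
      unfolding b_def
    proof (intro nn_integral_mono mult_right_mono ennreal_leI)
      fix \<theta>
      obtain u v where uv: "u \<in> g ` dyadics n" "v \<in> g ` dyadics n"
        "breadth (g ` dyadics n) (dir \<theta>) = u \<bullet> dir \<theta> - v \<bullet> dir \<theta>"
        by (rule breadth_attained[of "g ` dyadics n" "dir \<theta>"]) (auto intro: finite_imp_compact)
      then obtain p q where pq: "p \<le> 2^n" "q \<le> 2^n" "u = g (x p)" "v = g (x q)" unfolding dy by auto
      have "2 * (g (x p) \<bullet> dir \<theta> - g (x q) \<bullet> dir \<theta>) \<le> (\<Sum>i<2^n. \<bar>g (x i) \<bullet> dir \<theta> - g (x (Suc i)) \<bullet> dir \<theta>\<bar>)"
        using closed_variation_ge[of "\<lambda>i. g (x i) \<bullet> dir \<theta>" "2^n" p q] pq g(3) x01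
        by (simp add: pathfinish_def pathstart_def)
      then show "breadth (g ` dyadics n) (dir \<theta>) / 2 \<le> (\<Sum>i<2^n. \<bar>(g (x i) - g (x (Suc i))) \<bullet> dir \<theta>\<bar>) / 4"
        by (simp add: uv pq inner_diff_left)
    qed simp
    also have "\<dots> = (\<Sum>i<2^n. ennreal (dist (g (x i)) (g (x (Suc i)))))" by (rule len[symmetric])
    also have "\<dots> = (\<Sum>i<length ts - 1. ennreal (dist (g (ts ! i)) (g (ts ! Suc i))))"
      by (rule sum.cong) (auto simp: ts_def simp del: upt_Suc)
    also have "\<dots> \<le> path_length g"
      unfolding path_length_def using ts by (intro SUP_upper) auto
    finally show "(\<integral>\<^sup>+\<theta>. b n \<theta> \<partial>lborel) \<le> path_length g" .
  qed
  finally show "(\<integral>\<^sup>+\<theta>\<in>{0..2*pi}. ennreal (breadth K (dir \<theta>) / 2) \<partial>lborel) \<le> path_length g" .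
qed

text \<open>Supplies the witness for the \<open>THE\<close> in \<open>perim\<close>. Convex bodies
  of equal affine dimension have homeomorphic relative frontiers even in different spaces, so the
  circle can be taken in the complex plane, where \<open>circlepath\<close> lives.\<close>

lemma frontier_simple_path:
  fixes K :: "(real^2) set"
  assumes K: "convex K" "compact K" "interior K \<noteq> {}"
  obtains g where "simple_path g" "path_image g = frontier K" "pathfinish g = pathstart g"
proof -
  have "aff_dim K = aff_dim (cball 0 1 :: complex set)"
    using aff_dim_nonempty_interior[OF K(3)] aff_dim_nonempty_interior[of "cball 0 1 :: complex set"] by simp
  then have "rel_frontier (cball 0 1 :: complex set) homeomorphic rel_frontier K"
    using K by (intro homeomorphic_rel_frontiers_convex_bounded_sets) (auto simp: compact_imp_bounded)
  moreover have "rel_frontier K = frontier K" using K(3) by (rule rel_frontier_nonempty_interior)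
  moreover have "rel_frontier (cball 0 1 :: complex set) = sphere 0 1" by simp
  ultimately obtain h k where hk: "homeomorphism (sphere (0::complex) 1) (frontier K) h k"
    by (auto simp: homeomorphic_def)
  have im: "path_image (circlepath 0 1) = sphere (0::complex) 1" by simp
  show thesis
  proof
    show "simple_path (h \<circ> circlepath 0 1)"
      using hk by (intro simple_path_continuous_image)
        (auto simp: simple_path_circlepath homeomorphism_def intro: inj_on_inverseI)
    show "path_image (h \<circ> circlepath 0 1) = frontier K"
      using hk by (auto simp: path_image_compose homeomorphism_def)
    show "pathfinish (h \<circ> circlepath 0 1) = pathstart (h \<circ> circlepath 0 1)"
      by (simp add: pathfinish_compose pathstart_compose)
  qed
qed

theorem perim_eq_nn_integral_breadth:
  fixes K :: "(real^2) set"
  assumes K: "convex K" "compact K" "K \<noteq> {}"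
  shows "0 \<le> perim K"
    and "ennreal (perim K) = (\<integral>\<^sup>+\<theta>\<in>{0..2*pi}. ennreal (breadth K (dir \<theta>) / 2) \<partial>lborel)" (is "_ = ?I")
proof -
  have bK: "bounded K" by (rule compact_imp_bounded[OF K(2)])
  have "0 \<le> perim K \<and> ennreal (perim K) = ?I"
  proof (cases "interior K = {}")
    case True
    \<comment> \<open>With affine dimension 2 the interior would be the relative interior, which is
      nonempty for a nonempty convex set.\<close>
    have "collinear K"
    proof (rule ccontr)
      assume "\<not> collinear K"
      then have "aff_dim K = 2"
        using aff_dim_le_DIM[of K] by (simp add: collinear_aff_dim)
      then have "interior K = rel_interior K" by (simp add: interior_rel_interior_gen)
      then show False using True K rel_interior_eq_empty[of K] by simp
    qed
    then obtain a b where ab: "K = closed_segment a b"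
      using compact_convex_collinear_segment K by metis
    have "diameter K = norm (a - b)"
    proof (rule antisym)
      show "diameter K \<le> norm (a - b)"
        unfolding ab
      proof (rule diameter_le)
        fix x y assume xy: "x \<in> closed_segment a b" "y \<in> closed_segment a b"
        have "norm (x - y) \<le> norm (x - a) \<or> norm (x - y) \<le> norm (x - b)"
          using segment_furthest_le[OF xy(2), of x] by (simp add: norm_minus_commute)
        then show "norm (x - y) \<le> norm (a - b)"
          using segment_bound[OF xy(1)] by (auto simp: norm_minus_commute)
      qed simp
      show "norm (a - b) \<le> diameter K"
        using diameter_bounded_bound[OF bK, of a b] by (simp add: ab dist_norm)
    qed
    then have p: "perim K = 2 * norm (a - b)" using True by (simp add: perim_def)
    have "?I = (\<integral>\<^sup>+\<theta>. 2 * (ennreal (\<bar>(a - b) \<bullet> dir \<theta>\<bar> / 4) * indicator {0..2*pi} \<theta>) \<partial>lborel)"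
      by (intro nn_integral_cong)
        (simp add: ab breadth_segment mult.assoc[symmetric] ennreal_mult[symmetric] flip: ennreal_numeral)
    also have "\<dots> = 2 * ennreal (norm (a - b))"
      by (simp add: nn_integral_cmult inner_dir flip: nn_integral_abs_inner_dir)
    also have "\<dots> = ennreal (perim K)" by (simp add: p ennreal_mult)
    finally show ?thesis by (simp add: p)
  next
    case False
    obtain g where g: "simple_path g" "path_image g = frontier K" "pathfinish g = pathstart g"
      by (rule frontier_simple_path[OF K(1,2) False])
    \<comment> \<open>The \<open>THE\<close> asks for a real \<open>L\<close> with length
      \<open>ennreal L\<close>, which exists only if the integral is finite.\<close>
    have fin: "?I < \<infinity>"
    proof -
      obtain c where c: "\<And>x. x \<in> K \<Longrightarrow> norm x \<le> c" using bK bounded_iff by blast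
      have "support_fun K e \<le> c" if "norm e = 1" for e
      proof (rule support_fun_le[OF K(3)])
        show "x \<bullet> e \<le> c" if "x \<in> K" for x
          using norm_cauchy_schwarz[of x e] c[OF that] \<open>norm e = 1\<close> by simp
      qed
      then have "support_fun K (dir \<theta>) + support_fun K (- dir \<theta>) \<le> c + c" for \<theta>
        by (intro add_mono) auto
      then have "breadth K (dir \<theta>) / 2 \<le> c" for \<theta>
        unfolding breadth_def by (simp add: field_simps)
      then have "?I \<le> (\<integral>\<^sup>+\<theta>\<in>{0..2*pi}. ennreal c \<partial>lborel)"
        by (intro nn_integral_mono mult_right_mono ennreal_leI) auto
      also have "\<dots> < \<infinity>" by (simp add: nn_integral_cmult ennreal_mult_less_top)
      finally show ?thesis .
    qed
    define L0 where "L0 = enn2real ?I"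
    have L0: "0 \<le> L0" "ennreal L0 = ?I" using fin by (auto simp: L0_def)
    have "perim K = (THE L. L \<ge> 0 \<and> (\<exists>g. simple_path g \<and> pathfinish g = pathstart g \<and>
        path_image g = frontier K \<and> path_length g = ennreal L))"
      using False by (simp add: perim_def)
    also have "\<dots> = L0"
    proof (rule the_equality)
      show "L0 \<ge> 0 \<and> (\<exists>g. simple_path g \<and> pathfinish g = pathstart g \<and>
        path_image g = frontier K \<and> path_length g = ennreal L0)"
        using g path_length_frontier[OF K(1,2) False g] L0 by metis
      fix L assume "L \<ge> 0 \<and> (\<exists>g. simple_path g \<and> pathfinish g = pathstart g \<and>
        path_image g = frontier K \<and> path_length g = ennreal L)"
      then have "L \<ge> 0" "ennreal L = ennreal L0"
        using path_length_frontier[OF K(1,2) False] L0 by metis+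
      then show "L = L0" using L0(1) by simp
    qed
    finally show ?thesis using L0 by simp
  qed
  then show "0 \<le> perim K" "ennreal (perim K) = ?I" by auto
qed

section \<open>Joint laws and characteristic functions\<close>

text \<open>Normalised by its total mass \<open>w\<close>, the weight becomes a density, and Levy's
  uniqueness theorem applies to the two weighted laws. The masses agree by the hypothesis at
  \<open>t = 0\<close>; mass 0 cannot be normalised, but then both sides vanish.\<close>

lemma integral_weight_indicator_eq:
  fixes W :: "'a \<Rightarrow> real" and V :: "'b \<Rightarrow> real"
  assumes M: "prob_space M" and N: "prob_space N"
    and W: "W \<in> borel_measurable M" "\<And>x. 0 \<le> W x" "\<And>x. W x \<le> c"
    and V: "V \<in> borel_measurable N" "\<And>x. 0 \<le> V x" "\<And>x. V x \<le> c"
    and X: "X \<in> borel_measurable M" and Y: "Y \<in> borel_measurable N"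
    and eq: "\<And>t. (CLINT x|M. of_real (W x) * iexp (t * X x)) = (CLINT x|N. of_real (V x) * iexp (t * Y x))"
    and A: "A \<in> sets borel"
  shows "(LINT x|M. W x * indicator A (X x)) = (LINT x|N. V x * indicator A (Y x))"
proof -
  interpret M: prob_space M by fact
  interpret N: prob_space N by fact
  note [measurable] = W(1) V(1) X Y A
  have iW: "integrable M W" using W by (intro M.integrable_const_bound[of _ c]) auto
  have iV: "integrable N V" using V by (intro N.integrable_const_bound[of _ c]) auto
  define w where "w = (LINT x|M. W x)"
  have "(LINT x|M. W x) = (LINT x|N. V x)"
    using eq[of 0] by simp
  then have wV: "w = (LINT x|N. V x)" by (simp add: w_def)
  have "0 \<le> w" unfolding w_def using W(2) by (intro integral_nonneg_AE) auto
  show ?thesis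
  proof (cases "w = 0")
    case True
    have "AE x in M. W x = 0" using True iW W(2) by (subst integral_nonneg_eq_0_iff_AE[symmetric]) (auto simp: w_def)
    then have "(LINT x|M. W x * indicator A (X x)) = 0" by (intro integral_eq_zero_AE) auto
    moreover have "AE x in N. V x = 0" using True wV iV V(2) by (subst integral_nonneg_eq_0_iff_AE[symmetric]) auto
    then have "(LINT x|N. V x * indicator A (Y x)) = 0" by (intro integral_eq_zero_AE) auto
    ultimately show ?thesis by simp
  next
    case False
    then have w: "w > 0" using \<open>0 \<le> w\<close> by simp
    define M' where "M' = distr (density M (\<lambda>x. ennreal (W x / w))) borel X"
    define N' where "N' = distr (density N (\<lambda>x. ennreal (V x / w))) borel Y"
    have "prob_space (density M (\<lambda>x. ennreal (W x / w)))"
    proof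
      have "(\<integral>\<^sup>+x. ennreal (W x / w) \<partial>M) = ennreal (LINT x|M. W x / w)"
        using W(2) w iW by (intro nn_integral_eq_integral) auto
      also have "\<dots> = 1" using w by (simp flip: w_def)
      finally show "emeasure (density M (\<lambda>x. ennreal (W x / w))) (space (density M (\<lambda>x. ennreal (W x / w)))) = 1"
        by (simp add: emeasure_density)
    qed
    then interpret M'': prob_space "density M (\<lambda>x. ennreal (W x / w))" .
    have "prob_space (density N (\<lambda>x. ennreal (V x / w)))"
    proof
      have "(\<integral>\<^sup>+x. ennreal (V x / w) \<partial>N) = ennreal (LINT x|N. V x / w)"
        using V(2) w iV by (intro nn_integral_eq_integral) auto
      also have "\<dots> = 1" using w by (simp flip: wV)
      finally show "emeasure (density N (\<lambda>x. ennreal (V x / w))) (space (density N (\<lambda>x. ennreal (V x / w)))) = 1"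
        by (simp add: emeasure_density)
    qed
    then interpret N'': prob_space "density N (\<lambda>x. ennreal (V x / w))" .
    have dM: "real_distribution M'" unfolding M'_def by (rule M''.real_distribution_distr) simp
    have dN: "real_distribution N'" unfolding N'_def by (rule N''.real_distribution_distr) simp
    have intM: "(LINT x|M'. f x) = (LINT x|M. (W x / w) *\<^sub>R f (X x))"
      if [measurable]: "f \<in> borel_measurable borel" for f :: "real \<Rightarrow> 'c::{banach, second_countable_topology}"
      using W(2) w unfolding M'_def by (simp add: integral_distr integral_density)
    have intN: "(LINT x|N'. f x) = (LINT x|N. (V x / w) *\<^sub>R f (Y x))"
      if [measurable]: "f \<in> borel_measurable borel" for f :: "real \<Rightarrow> 'c::{banach, second_countable_topology}"
      using V(2) w unfolding N'_def by (simp add: integral_distr integral_density)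
    have "char M' t = char N' t" for t
    proof -
      have "char M' t = (CLINT x|M. (of_real (W x) * iexp (t * X x)) / of_real w)"
        unfolding char_def by (subst intM) (auto simp: scaleR_conv_of_real)
      also have "\<dots> = (CLINT x|N. (of_real (V x) * iexp (t * Y x)) / of_real w)"
        using eq[of t] by simp
      also have "\<dots> = char N' t"
        unfolding char_def by (subst intN) (auto simp: scaleR_conv_of_real)
      finally show ?thesis .
    qed
    then have "M' = N'" by (intro Levy_uniqueness dM dN) auto
    then have "(LINT x|M'. indicator A x :: real) = (LINT x|N'. indicator A x)" by simp
    then have "(LINT x|M. (W x / w) *\<^sub>R indicator A (X x) :: real) = (LINT x|N. (V x / w) *\<^sub>R indicator A (Y x))"
      by (simp only: intM intN borel_measurable_indicator A)
    then show ?thesis using w by simp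
  qed
qed

lemma integral_Complex:
  assumes "integrable M f" "integrable M g"
  shows "(CLINT x|M. of_real (f x) + \<i> * of_real (g x)) = of_real (LINT x|M. f x) + \<i> * of_real (LINT x|M. g x)"
  using assms by (subst Bochner_Integration.integral_add) auto

lemma integrable_weight_iexp:
  fixes W :: "'a \<Rightarrow> real"
  assumes "prob_space M" "W \<in> borel_measurable M" "\<And>x. 0 \<le> W x" "\<And>x. W x \<le> c" "Z \<in> borel_measurable M"
  shows "integrable M (\<lambda>x. of_real (W x) * iexp (Z x))"
proof -
  interpret prob_space M by fact
  note [measurable] = assms(2,5)
  show ?thesis
    using assms(3,4) by (intro integrable_const_bound[of _ c]) (auto simp: norm_mult)
qed

text \<open>Induction on the index set, peeling off one variable at a time. One-dimensional Levy
  uniqueness needs positive weights, hence the weights \<open>1 + cos (s + \<phi>)\<close> instead of the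
  complex weight \<open>iexp s\<close>.\<close>

lemma integral_weight_prod_indicator_eq:
  fixes W :: "'a \<Rightarrow> real" and V :: "'b \<Rightarrow> real" and X :: "'i \<Rightarrow> 'a \<Rightarrow> real" and Y :: "'i \<Rightarrow> 'b \<Rightarrow> real"
  assumes M: "prob_space M" and N: "prob_space N" and "finite J"
    and X: "\<And>j. j \<in> J \<Longrightarrow> X j \<in> borel_measurable M" and Y: "\<And>j. j \<in> J \<Longrightarrow> Y j \<in> borel_measurable N"
    and W: "W \<in> borel_measurable M" "\<And>x. 0 \<le> W x" "\<And>x. W x \<le> c"
    and V: "V \<in> borel_measurable N" "\<And>x. 0 \<le> V x" "\<And>x. V x \<le> c"
    and eq: "\<And>a. (CLINT x|M. of_real (W x) * iexp (\<Sum>j\<in>J. a j * X j x)) =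
                 (CLINT x|N. of_real (V x) * iexp (\<Sum>j\<in>J. a j * Y j x))"
    and A: "\<And>j. j \<in> J \<Longrightarrow> A j \<in> sets borel"
  shows "(LINT x|M. W x * (\<Prod>j\<in>J. indicator (A j) (X j x))) = (LINT x|N. V x * (\<Prod>j\<in>J. indicator (A j) (Y j x)))"
  using \<open>finite J\<close> X Y W V eq A
proof (induction J arbitrary: W V rule: finite_induct)
  case empty
  then show ?case using empty.prems(9)[of "\<lambda>_. 0"] by simp
next
  case (insert k J)
  interpret M: prob_space M by fact
  interpret N: prob_space N by fact
  have X[measurable]: "X k \<in> borel_measurable M" "\<And>j. j \<in> J \<Longrightarrow> X j \<in> borel_measurable M"
    and Y[measurable]: "Y k \<in> borel_measurable N" "\<And>j. j \<in> J \<Longrightarrow> Y j \<in> borel_measurable N" 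
    using insert.prems(1,2) by auto
  note W[measurable] = insert.prems(3) and V[measurable] = insert.prems(6)
  note W' = insert.prems(4,5) and V' = insert.prems(7,8)
  have Ak[measurable]: "A k \<in> sets borel" using insert.prems(10) by simp
  have eq: "(CLINT x|M. of_real (W x) * iexp (t * X k x + (\<Sum>j\<in>J. a j * X j x))) =
                 (CLINT x|N. of_real (V x) * iexp (t * Y k x + (\<Sum>j\<in>J. a j * Y j x)))" for a t
  proof -
    have "(\<Sum>j\<in>J. (if j = k then t else a j) * f j) = (\<Sum>j\<in>J. a j * f j)" for f :: "'i \<Rightarrow> real"
      using insert.hyps(2) by (intro sum.cong) auto
    then show ?thesis using insert.prems(9)[of "\<lambda>j. if j = k then t else a j"] insert.hyps by simp
  qed
  let ?SX = "\<lambda>a x. \<Sum>j\<in>J. a j * X j x" and ?SY = "\<lambda>a x. \<Sum>j\<in>J. a j * Y j x"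
  have iX: "integrable M (\<lambda>x. of_real (W x) * iexp (t * X k x + ?SX a x))" for t a
    using W W' by (intro integrable_weight_iexp[OF M, of _ c]) auto
  have iY: "integrable N (\<lambda>x. of_real (V x) * iexp (t * Y k x + ?SY a x))" for t a
    using V V' by (intro integrable_weight_iexp[OF N, of _ c]) auto
  \<comment> \<open>The positive weight \<open>1 + cos (s + \<phi>)\<close> is a combination of
    \<open>1\<close> and \<open>iexp\<close> of \<open>s\<close> and of \<open>- s\<close>. After
    multiplication by \<open>iexp u\<close> every term has the shape covered by \<open>eq\<close>,
    with coefficients \<open>0\<close>, \<open>a\<close> and \<open>- a\<close>.\<close>
  have trig: "of_real (w * (1 + cos (s + \<phi>))) * iexp u =
      of_real w * iexp (u + 0) + (of_real w * iexp (u + s) * cis \<phi> + of_real w * iexp (u + - s) * cis (- \<phi>)) / 2"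
    for w s u \<phi>
    unfolding cis_conv_exp[symmetric] mult.assoc cis_mult
    by (simp add: complex_eq_iff cos_add sin_add cos_diff sin_diff field_simps)
  have neg: "(\<Sum>j\<in>J. (- a j) * f j) = - (\<Sum>j\<in>J. a j * f j)" for a f :: "'i \<Rightarrow> real"
    by (simp add: sum_negf)
  have c1: "0 \<le> 1 + cos z" "1 + cos z \<le> 2" for z :: real
    using cos_ge_minus_one[of z] cos_le_one[of z] by linarith+
  have "0 \<le> c" using W'(1,2) order_trans by blast
  then have bd: "w * (1 + cos z) \<le> c * 2" if "0 \<le> w" "w \<le> c" for w z
    using that c1[of z] by (intro mult_mono) auto
  have C: "(LINT x|M. W x * (1 + cos (?SX a x + \<phi>)) * indicator (A k) (X k x)) =
        (LINT x|N. V x * (1 + cos (?SY a x + \<phi>)) * indicator (A k) (Y k x))" for a \<phi>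
  proof (rule integral_weight_indicator_eq[OF M N, where c = "c * 2"])
    fix t
    show "(CLINT x|M. of_real (W x * (1 + cos (?SX a x + \<phi>))) * iexp (t * X k x)) =
      (CLINT x|N. of_real (V x * (1 + cos (?SY a x + \<phi>))) * iexp (t * Y k x))"
      unfolding trig
      using iX[of t "\<lambda>_. 0"] iX[of t a] iX[of t "\<lambda>j. - a j"] iY[of t "\<lambda>_. 0"] iY[of t a] iY[of t "\<lambda>j. - a j"]
        eq[of t "\<lambda>_. 0"] eq[of t a] eq[of t "\<lambda>j. - a j"]
      unfolding neg by simp
  qed (use W' V' c1 bd in \<open>auto simp: mult_nonneg_nonneg\<close>)
  have iI: "integrable M (\<lambda>x. W x * f x * indicator (A k) (X k x))"
    if [measurable]: "f \<in> borel_measurable M" and f: "\<And>x. \<bar>f x\<bar> \<le> 1" for f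
    using W' f \<open>0 \<le> c\<close> mult_mono[OF W'(2) f]
    by (intro M.integrable_const_bound[of _ c]) (auto simp: abs_mult split: split_indicator)
  have iJ: "integrable N (\<lambda>x. V x * f x * indicator (A k) (Y k x))"
    if [measurable]: "f \<in> borel_measurable N" and f: "\<And>x. \<bar>f x\<bar> \<le> 1" for f
    using V' f \<open>0 \<le> c\<close> mult_mono[OF V'(2) f]
    by (intro N.integrable_const_bound[of _ c]) (auto simp: abs_mult split: split_indicator)
  \<comment> \<open>With \<open>a = 0\<close> and phase \<open>pi/2\<close> the cosine vanishes and
    the bare weight is left. Subtracting it from \<open>C\<close> isolates the cosine in
    \<open>D\<close>.\<close>
  have 0: "(LINT x|M. W x * 1 * indicator (A k) (X k x)) = (LINT x|N. V x * 1 * indicator (A k) (Y k x))"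
    using C[of "\<lambda>_. 0" "pi/2"] by simp
  have D: "(LINT x|M. W x * cos (?SX a x + \<phi>) * indicator (A k) (X k x)) =
        (LINT x|N. V x * cos (?SY a x + \<phi>) * indicator (A k) (Y k x))" for a \<phi>
    using C[of a \<phi>] 0 iI[of "\<lambda>_. 1"] iJ[of "\<lambda>_. 1"] iI[of "\<lambda>x. cos (?SX a x + \<phi>)"] iJ[of "\<lambda>x. cos (?SY a x + \<phi>)"]
    by (simp add: distrib_left distrib_right)
  \<comment> \<open>Phases \<open>0\<close> and \<open>- pi/2\<close> give the real and the
    imaginary part of \<open>iexp s\<close>. Together they restore the hypothesis on characteristic
    functions for \<open>J\<close>, with the indicator of \<open>X k\<close> absorbed into the
    weight.\<close>
  have S: "cos (s + - pi / 2) = sin s" for s :: real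
    by (simp add: cos_diff)
  have "(LINT x|M. (W x * indicator (A k) (X k x)) * (\<Prod>j\<in>J. indicator (A j) (X j x))) =
     (LINT x|N. (V x * indicator (A k) (Y k x)) * (\<Prod>j\<in>J. indicator (A j) (Y j x)))"
  proof (rule insert.IH)
    fix a
    have "(CLINT x|M. of_real (W x * indicator (A k) (X k x)) * iexp (?SX a x)) =
      (CLINT x|M. of_real (W x * cos (?SX a x + 0) * indicator (A k) (X k x)) +
         \<i> * of_real (W x * cos (?SX a x + - pi / 2) * indicator (A k) (X k x)))"
      unfolding S cis_conv_exp[symmetric]
      by (intro Bochner_Integration.integral_cong refl) (simp add: complex_eq_iff)
    also have "\<dots> = of_real (LINT x|M. W x * cos (?SX a x + 0) * indicator (A k) (X k x)) +
         \<i> * of_real (LINT x|M. W x * cos (?SX a x + - pi / 2) * indicator (A k) (X k x))"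
      by (rule integral_Complex; rule iI) simp_all
    also have "\<dots> = of_real (LINT x|N. V x * cos (?SY a x + 0) * indicator (A k) (Y k x)) +
         \<i> * of_real (LINT x|N. V x * cos (?SY a x + - pi / 2) * indicator (A k) (Y k x))"
      by (simp only: D)
    also have "\<dots> = (CLINT x|N. of_real (V x * cos (?SY a x + 0) * indicator (A k) (Y k x)) +
         \<i> * of_real (V x * cos (?SY a x + - pi / 2) * indicator (A k) (Y k x)))"
      by (rule integral_Complex[symmetric]; rule iJ) simp_all
    also have "\<dots> = (CLINT x|N. of_real (V x * indicator (A k) (Y k x)) * iexp (?SY a x))"
      unfolding S cis_conv_exp[symmetric]
      by (intro Bochner_Integration.integral_cong refl) (simp add: complex_eq_iff)
    finally show "(CLINT x|M. of_real (W x * indicator (A k) (X k x)) * iexp (?SX a x)) =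
       (CLINT x|N. of_real (V x * indicator (A k) (Y k x)) * iexp (?SY a x))" .
  qed (use W' V' \<open>0 \<le> c\<close> insert.prems(10) in \<open>auto simp: indicator_def\<close>)
  then show ?case using insert.hyps by (simp add: mult.assoc)
qed

text \<open>The uniqueness theorem for characteristic functions in several dimensions: constant
  weight 1 in the preceding lemma gives agreement on boxes, and boxes form an intersection-stable
  generator of the product sigma-algebra.\<close>

lemma distr_PiM_eqI_char:
  fixes X :: "'i \<Rightarrow> 'a \<Rightarrow> real" and Y :: "'i \<Rightarrow> 'b \<Rightarrow> real"
  assumes M: "prob_space M" and N: "prob_space N" and J: "finite J"
    and X: "\<And>j. j \<in> J \<Longrightarrow> X j \<in> borel_measurable M" and Y: "\<And>j. j \<in> J \<Longrightarrow> Y j \<in> borel_measurable N"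
    and eq: "\<And>a. (CLINT x|M. iexp (\<Sum>j\<in>J. a j * X j x)) = (CLINT x|N. iexp (\<Sum>j\<in>J. a j * Y j x))"
  shows "distr M (PiM J (\<lambda>_. borel)) (\<lambda>x. \<lambda>j\<in>J. X j x) = distr N (PiM J (\<lambda>_. borel)) (\<lambda>x. \<lambda>j\<in>J. Y j x)"
proof (rule measure_eqI_PiM_finite[OF J, where M = "\<lambda>_. borel" and A = "\<lambda>_::nat. PiE J (\<lambda>_. UNIV)"])
  interpret M: prob_space M by fact
  interpret N: prob_space N by fact
  note [measurable] = X Y
  have mX[measurable]: "(\<lambda>x. \<lambda>j\<in>J. X j x) \<in> measurable M (PiM J (\<lambda>_. borel))"
    by (rule measurable_restrict) (rule X)
  have mY[measurable]: "(\<lambda>x. \<lambda>j\<in>J. Y j x) \<in> measurable N (PiM J (\<lambda>_. borel))"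
    by (rule measurable_restrict) (rule Y)
  interpret MX: prob_space "distr M (PiM J (\<lambda>_. borel)) (\<lambda>x. \<lambda>j\<in>J. X j x)" by (rule M.prob_space_distr) simp
  show "range (\<lambda>_::nat. PiE J (\<lambda>_. UNIV :: real set)) \<subseteq> prod_algebra J (\<lambda>_. borel)"
    using J by (auto intro!: prod_algebraI_finite)
  show "emeasure (distr M (PiM J (\<lambda>_. borel)) (\<lambda>x. \<lambda>j\<in>J. X j x)) (PiE J (\<lambda>_. UNIV)) \<noteq> \<infinity>" by simp
  fix A :: "'i \<Rightarrow> real set" assume A: "\<And>i. i \<in> J \<Longrightarrow> A i \<in> sets borel"
  then have [measurable]: "PiE J A \<in> sets (PiM J (\<lambda>_. borel))" using J by (intro sets_PiM_I_finite) auto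
  have ind: "(\<Prod>j\<in>J. indicator (A j) (f j)) = (indicator (PiE J A) (\<lambda>j\<in>J. f j) :: real)" for f
  proof (cases "\<forall>j\<in>J. f j \<in> A j")
    case True
    then show ?thesis by (simp add: indicator_def restrict_PiE_iff)
  next
    case False
    then obtain j where "j \<in> J" "indicator (A j) (f j) = (0::real)" by auto
    then have "(\<Prod>j\<in>J. indicator (A j) (f j) :: real) = 0" using J by (blast intro: prod_zero)
    moreover have "restrict f J \<notin> PiE J A" using False by (auto simp: restrict_PiE_iff)
    ultimately show ?thesis by simp
  qed
  have "emeasure (distr M (PiM J (\<lambda>_. borel)) (\<lambda>x. \<lambda>j\<in>J. X j x)) (PiE J A) 
      = ennreal (LINT x|M. indicator (PiE J A) (\<lambda>j\<in>J. X j x))"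
    by (subst integral_distr[symmetric, where f = "indicator (PiE J A)" and N = "PiM J (\<lambda>_. borel)"])
      (auto simp: MX.emeasure_eq_measure)
  also have "(LINT x|M. indicator (PiE J A) (\<lambda>j\<in>J. X j x)) = (LINT x|N. indicator (PiE J A) (\<lambda>j\<in>J. Y j x) :: real)"
    unfolding ind[symmetric]
    using integral_weight_prod_indicator_eq[where W = "\<lambda>_. 1" and V = "\<lambda>_. 1" and c = 1,
        OF M N J X Y _ _ _ _ _ _ _ A] eq
    by (simp only: of_real_1 mult_1 order_refl zero_le_one borel_measurable_const)
  also have "ennreal \<dots> = emeasure (distr N (PiM J (\<lambda>_. borel)) (\<lambda>x. \<lambda>j\<in>J. Y j x)) (PiE J A)"
  proof -
    interpret NY: prob_space "distr N (PiM J (\<lambda>_. borel)) (\<lambda>x. \<lambda>j\<in>J. Y j x)" by (rule N.prob_space_distr) simp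
    show ?thesis
      by (subst integral_distr[symmetric, where f = "indicator (PiE J A)" and N = "PiM J (\<lambda>_. borel)"])
        (simp_all add: NY.emeasure_eq_measure)
  qed
  finally show "emeasure (distr M (PiM J (\<lambda>_. borel)) (\<lambda>x. \<lambda>j\<in>J. X j x)) (PiE J A) =
    emeasure (distr N (PiM J (\<lambda>_. borel)) (\<lambda>x. \<lambda>j\<in>J. Y j x)) (PiE J A)" .
qed (auto simp: space_PiM)

section \<open>Spitzer's identity\<close>

primrec walk_max :: "(nat \<Rightarrow> real) \<Rightarrow> nat \<Rightarrow> real" where
  "walk_max x 0 = 0"
| "walk_max x (Suc n) = max (walk_max x n) (\<Sum>i<Suc n. x i)"

lemma walk_max_nonneg: "0 \<le> walk_max x n"
  by (induction n) auto

lemma walk_max_ge_sum: "k \<le> n \<Longrightarrow> (\<Sum>i<k. x i) \<le> walk_max x n"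
  by (induction n) (auto simp: le_Suc_eq)

lemma walk_max_cong: "(\<And>i. i < n \<Longrightarrow> x i = y i) \<Longrightarrow> walk_max x n = walk_max y n"
proof (induction n)
  case (Suc n)
  then have "walk_max x n = walk_max y n" "(\<Sum>i<Suc n. x i) = (\<Sum>i<Suc n. y i)" by (auto intro!: sum.cong)
  then show ?case by simp
qed simp

text \<open>Every partial sum except the empty one contains the first increment.\<close>

lemma walk_max_Suc_shift: "walk_max x (Suc n) = max 0 (x 0 + walk_max (\<lambda>i. x (Suc i)) n)"
proof (induction n)
  case (Suc n)
  have "walk_max x (Suc (Suc n)) = max (walk_max x (Suc n)) (\<Sum>i<Suc (Suc n). x i)" by simp
  also have "(\<Sum>i<Suc (Suc n). x i) = x 0 + (\<Sum>i<Suc n. x (Suc i))" by (rule sum.lessThan_Suc_shift)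
  finally show ?case unfolding Suc.IH by (simp add: max_def)
qed simp

lemma walk_max_eq_Max: "walk_max x n = Max ((\<lambda>k. \<Sum>i<k. x i) ` {..n})"
  by (induction n) (simp_all add: atMost_Suc max.commute)

lemma walk_max_Suc_cases:
  "walk_max x (Suc n) = walk_max x n + 
     (if (\<Sum>i<Suc n. x i) > 0 then x 0 + walk_max (\<lambda>i. x (Suc i)) n - walk_max x n else 0)"
proof (cases "(\<Sum>i<Suc n. x i) > 0")
  case True
  moreover have "(\<Sum>i<Suc n. x i) = x 0 + (\<Sum>i<n. x (Suc i))" by (rule sum.lessThan_Suc_shift)
  moreover have "(\<Sum>i<n. x (Suc i)) \<le> walk_max (\<lambda>i. x (Suc i)) n" by (rule walk_max_ge_sum) simp
  ultimately show ?thesis unfolding walk_max_Suc_shift by auto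
next
  case False
  then show ?thesis using walk_max_nonneg[of x n] by auto
qed

lemma measurable_walk_max:
  assumes "\<And>i. i < n \<Longrightarrow> (\<lambda>\<omega>. f i \<omega>) \<in> borel_measurable M"
  shows "(\<lambda>\<omega>. walk_max (\<lambda>i. f i \<omega>) n) \<in> borel_measurable M"
  using assms
proof (induction n)
  case (Suc n)
  have "(\<lambda>\<omega>. \<Sum>i<Suc n. f i \<omega>) \<in> borel_measurable M"
    using Suc.prems by (intro borel_measurable_sum) simp
  then show ?case using Suc unfolding walk_max.simps by (intro borel_measurable_max) auto
qed simp

lemma integrable_walk_max:
  assumes "\<And>i. i < n \<Longrightarrow> integrable M (f i)"
  shows "integrable M (\<lambda>\<omega>. walk_max (\<lambda>i. f i \<omega>) n)"
  using assms
proof (induction n)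
  case (Suc n)
  have "integrable M (\<lambda>\<omega>. \<Sum>i<Suc n. f i \<omega>)"
    using Suc.prems by (intro Bochner_Integration.integrable_sum) simp
  then show ?case using Suc unfolding walk_max.simps by (intro integrable_max) auto
qed simp

lemma sum_rotate: "(\<Sum>i<m. f (Suc i mod m)) = (\<Sum>i<m. f i :: 'a::comm_monoid_add)"
proof (cases m)
  case (Suc k)
  have "(\<Sum>i<Suc k. f (Suc i mod Suc k)) = (\<Sum>i<k. f (Suc i mod Suc k)) + f 0" by simp
  also have "(\<Sum>i<k. f (Suc i mod Suc k)) = (\<Sum>i<k. f (Suc i))" by (intro sum.cong) auto
  also have "(\<Sum>i<k. f (Suc i)) + f 0 = (\<Sum>i<Suc k. f i)" unfolding sum.lessThan_Suc_shift by (rule add.commute)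
  finally show ?thesis using Suc by simp
qed simp

text \<open>On \<open>S\<^sub>n > 0\<close> the maximum is the first increment plus the maximum of the shifted walk.\<close>

theorem expectation_walk_max:
  fixes \<xi> :: "nat \<Rightarrow> 'a \<Rightarrow> real"
  assumes M: "prob_space M" and int: "\<And>i. i < n \<Longrightarrow> integrable M (\<xi> i)"
    and shift: "\<And>m. m \<le> n \<Longrightarrow> distr M (\<Pi>\<^sub>M i\<in>{..<m}. borel) (\<lambda>\<omega>. \<lambda>i\<in>{..<m}. \<xi> i \<omega>) =
      distr M (\<Pi>\<^sub>M i\<in>{..<m}. borel) (\<lambda>\<omega>. \<lambda>i\<in>{..<m}. \<xi> (Suc i mod m) \<omega>)"
  shows "(LINT \<omega>|M. walk_max (\<lambda>i. \<xi> i \<omega>) n) = (\<Sum>k<n. (LINT \<omega>|M. max 0 (\<Sum>i<Suc k. \<xi> i \<omega>)) / Suc k)"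
  using int shift
proof (induction n)
  case (Suc n)
  let ?m = "Suc n"
  define P where "P x = (if (\<Sum>i<?m. x i) > 0 then 1 else 0 :: real)" for x :: "nat \<Rightarrow> real"
  have meas: "\<And>i. i < ?m \<Longrightarrow> \<xi> i \<in> borel_measurable M" using Suc.prems(1) by blast
  have modless: "Suc i mod ?m < ?m" for i by simp
  have S: "(\<lambda>\<omega>. \<Sum>i<?m. \<xi> i \<omega>) \<in> borel_measurable M" by (rule borel_measurable_sum) (simp add: meas)
  have P_meas: "(\<lambda>y. P (f y)) \<in> borel_measurable N"
    if [measurable]: "(\<lambda>y. \<Sum>i<?m. f y i) \<in> borel_measurable N" for f :: "'b \<Rightarrow> nat \<Rightarrow> real" and N
    unfolding P_def by (intro measurable_If) (simp_all del: sum.lessThan_Suc)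
  \<comment> \<open>The total sum does not change under rotation, so the event may be carried along
    whenever the increments are rotated.\<close>
  have Prot: "P (\<lambda>i. x (Suc i mod ?m)) = P x" for x unfolding P_def by (simp only: sum_rotate)
  have Pm: "(\<lambda>\<omega>. P (\<lambda>i. \<xi> i \<omega>)) \<in> borel_measurable M" by (rule P_meas[OF S])
  have Pb: "integrable M (\<lambda>\<omega>. P (\<lambda>i. \<xi> i \<omega>) * f \<omega>)" if "integrable M f" for f
  proof (rule Bochner_Integration.integrable_bound[OF that])
    show "(\<lambda>\<omega>. P (\<lambda>i. \<xi> i \<omega>) * f \<omega>) \<in> borel_measurable M" using Pm that by simp
    show "AE \<omega> in M. norm (P (\<lambda>i. \<xi> i \<omega>) * f \<omega>) \<le> norm (f \<omega>)"
      by (rule AE_I2) (simp add: P_def)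
  qed
  have coord: "(\<lambda>x::nat \<Rightarrow> real. x i) \<in> borel_measurable (\<Pi>\<^sub>M i\<in>{..<?m}. borel)" if "i < ?m" for i
    using measurable_component_singleton[of i "{..<?m}" "\<lambda>_. borel"] that by simp
  have trans: "(LINT \<omega>|M. F (\<lambda>i\<in>{..<?m}. \<xi> i \<omega>)) = (LINT \<omega>|M. F (\<lambda>i\<in>{..<?m}. \<xi> (Suc i mod ?m) \<omega>))"
    if F[measurable]: "F \<in> borel_measurable (\<Pi>\<^sub>M i\<in>{..<?m}. borel)" for F :: "_ \<Rightarrow> real"
  proof -
    have 1: "(\<lambda>\<omega>. \<lambda>i\<in>{..<?m}. \<xi> i \<omega>) \<in> measurable M (\<Pi>\<^sub>M i\<in>{..<?m}. borel)"
      by (rule measurable_restrict) (simp add: meas)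
    have 2: "(\<lambda>\<omega>. \<lambda>i\<in>{..<?m}. \<xi> (Suc i mod ?m) \<omega>) \<in> measurable M (\<Pi>\<^sub>M i\<in>{..<?m}. borel)"
      by (rule measurable_restrict) (rule meas[OF modless])
    have "(LINT \<omega>|M. F (\<lambda>i\<in>{..<?m}. \<xi> i \<omega>)) =
        (LINT x|distr M (\<Pi>\<^sub>M i\<in>{..<?m}. borel) (\<lambda>\<omega>. \<lambda>i\<in>{..<?m}. \<xi> i \<omega>). F x)"
      by (rule integral_distr[OF 1 F, symmetric])
    also have "\<dots> = (LINT \<omega>|M. F (\<lambda>i\<in>{..<?m}. \<xi> (Suc i mod ?m) \<omega>))"
      unfolding Suc.prems(2)[OF order_refl] by (rule integral_distr[OF 2 F])
    finally show ?thesis .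
  qed
  have PS: "(\<lambda>x::nat \<Rightarrow> real. \<Sum>i<?m. x i) \<in> borel_measurable (\<Pi>\<^sub>M i\<in>{..<?m}. borel)" 
    by (rule borel_measurable_sum[where S = "{..<?m}" and f = "\<lambda>i x. x i"]) (rule coord, simp)
  have Pr: "P (restrict x {..<?m}) = P x" for x
  proof -
    have "(\<Sum>i<?m. restrict x {..<?m} i) = (\<Sum>i<?m. x i)" by (rule sum.cong) auto
    then show ?thesis by (simp only: P_def)
  qed
  have PM: "P \<in> borel_measurable (\<Pi>\<^sub>M i\<in>{..<?m}. borel)" by (rule P_meas[OF PS])
  have wr: "walk_max (restrict x {..<?m}) n = walk_max x n" for x by (rule walk_max_cong) simp
  have "(LINT \<omega>|M. P (\<lambda>i. \<xi> i \<omega>) * walk_max (\<lambda>i. \<xi> i \<omega>) n)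
      = (LINT \<omega>|M. P (\<lambda>i. \<xi> (Suc i mod ?m) \<omega>) * walk_max (\<lambda>i. \<xi> (Suc i mod ?m) \<omega>) n)"
    using trans[of "\<lambda>x. P x * walk_max x n", OF borel_measurable_times[OF PM measurable_walk_max]]
    by (simp only: Pr wr coord less_Suc_eq simp_thms)
  \<comment> \<open>The first \<open>n\<close> rotated indices are \<open>1, ..., n\<close>. The
    wrapped index 0 comes last, where \<open>walk_max _ n\<close> no longer looks.\<close>
  also have "\<dots> = (LINT \<omega>|M. P (\<lambda>i. \<xi> i \<omega>) * walk_max (\<lambda>i. \<xi> (Suc i) \<omega>) n)"
    by (intro Bochner_Integration.integral_cong refl arg_cong2[of _ _ _ _ "(*)"] Prot walk_max_cong) simp
  finally have wm: "(LINT \<omega>|M. P (\<lambda>i. \<xi> i \<omega>) * walk_max (\<lambda>i. \<xi> i \<omega>) n)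
      = (LINT \<omega>|M. P (\<lambda>i. \<xi> i \<omega>) * walk_max (\<lambda>i. \<xi> (Suc i) \<omega>) n)" .
  have step: "(LINT \<omega>|M. P (\<lambda>i. \<xi> i \<omega>) * \<xi> i \<omega>) = (LINT \<omega>|M. P (\<lambda>i. \<xi> i \<omega>) * \<xi> (Suc i) \<omega>)" if "i < n" for i
  proof -
    have "(LINT \<omega>|M. P (\<lambda>i. \<xi> i \<omega>) * \<xi> i \<omega>) = (LINT \<omega>|M. P (\<lambda>i. \<xi> (Suc i mod ?m) \<omega>) * \<xi> (Suc i mod ?m) \<omega>)"
      using trans[of "\<lambda>x. P x * x i", OF borel_measurable_times[OF PM coord]] that
      by (simp only: Pr restrict_apply lessThan_iff less_Suc_eq if_True simp_thms)
    also have "\<dots> = (LINT \<omega>|M. P (\<lambda>i. \<xi> i \<omega>) * \<xi> (Suc i) \<omega>)" using that by (simp only: Prot[of "\<lambda>i. \<xi> i _"] mod_less Suc_less_eq)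
    finally show ?thesis .
  qed
  \<comment> \<open>On the event every increment contributes equally, so the first one accounts for
    the fraction \<open>1 / Suc n\<close> of the mean positive part of the total sum. This is the
    source of the divisor in the identity.\<close>
  have all: "(LINT \<omega>|M. P (\<lambda>i. \<xi> i \<omega>) * \<xi> i \<omega>) = (LINT \<omega>|M. P (\<lambda>i. \<xi> i \<omega>) * \<xi> 0 \<omega>)" if "i < ?m" for i
    using that by (induction i) (simp_all add: step[symmetric])
  have "(LINT \<omega>|M. max 0 (\<Sum>i<?m. \<xi> i \<omega>)) = (LINT \<omega>|M. (\<Sum>i<?m. P (\<lambda>i. \<xi> i \<omega>) * \<xi> i \<omega>))"
    unfolding sum_distrib_left[symmetric]
    by (intro Bochner_Integration.integral_cong refl) (simp add: P_def max_def del: sum.lessThan_Suc)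
  also have "\<dots> = (\<Sum>i<?m. (LINT \<omega>|M. P (\<lambda>i. \<xi> i \<omega>) * \<xi> i \<omega>))"
    using Suc.prems(1) by (intro Bochner_Integration.integral_sum Pb) auto
  also have "\<dots> = (\<Sum>i<?m. (LINT \<omega>|M. P (\<lambda>i. \<xi> i \<omega>) * \<xi> 0 \<omega>))" by (intro sum.cong refl all) simp
  also have "\<dots> = ?m * (LINT \<omega>|M. P (\<lambda>i. \<xi> i \<omega>) * \<xi> 0 \<omega>)" by simp
  finally have first: "(LINT \<omega>|M. P (\<lambda>i. \<xi> i \<omega>) * \<xi> 0 \<omega>) = (LINT \<omega>|M. max 0 (\<Sum>i<?m. \<xi> i \<omega>)) / ?m" by simp
  have i1: "integrable M (\<lambda>\<omega>. walk_max (\<lambda>i. \<xi> i \<omega>) n)" using Suc.prems(1) by (intro integrable_walk_max) simp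
  have i2: "integrable M (\<lambda>\<omega>. walk_max (\<lambda>i. \<xi> (Suc i) \<omega>) n)" using Suc.prems(1) by (intro integrable_walk_max) simp
  have i3: "integrable M (\<xi> 0)" using Suc.prems(1) by simp
  have "(LINT \<omega>|M. walk_max (\<lambda>i. \<xi> i \<omega>) ?m) = (LINT \<omega>|M. walk_max (\<lambda>i. \<xi> i \<omega>) n +
      (P (\<lambda>i. \<xi> i \<omega>) * \<xi> 0 \<omega> + P (\<lambda>i. \<xi> i \<omega>) * walk_max (\<lambda>i. \<xi> (Suc i) \<omega>) n - P (\<lambda>i. \<xi> i \<omega>) * walk_max (\<lambda>i. \<xi> i \<omega>) n))"
    unfolding walk_max_Suc_cases P_def by (intro Bochner_Integration.integral_cong refl) auto
  also have "\<dots> = (LINT \<omega>|M. walk_max (\<lambda>i. \<xi> i \<omega>) n) + (LINT \<omega>|M. P (\<lambda>i. \<xi> i \<omega>) * \<xi> 0 \<omega>)"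
    using i1 Pb[OF i1] Pb[OF i2] Pb[OF i3] by (simp add: wm)
  finally show ?case using Suc.IH Suc.prems by (simp add: first)
qed simp

section \<open>Riemann sums\<close>

text \<open>\<open>g\<close> may blow up at 0, so each cell is compared with the increment of the
  primitive \<open>G\<close> by the mean value theorem. Right end points give the upper bound
  \<open>G 1 - G 0\<close>. Comparison with the next cell gives a lower bound that misses only the
  increment of \<open>G\<close> over the first cell, which vanishes by continuity of
  \<open>G\<close> at 0.\<close>

lemma riemann_sum_antimono_LIMSEQ:
  fixes G g :: "real \<Rightarrow> real"
  assumes G: "continuous_on {0..1} G"
    and deriv: "\<And>t. 0 < t \<Longrightarrow> t < 1 \<Longrightarrow> (G has_real_derivative g t) (at t)"
    and anti: "\<And>s t. 0 < s \<Longrightarrow> s \<le> t \<Longrightarrow> t \<le> 1 \<Longrightarrow> g t \<le> g s"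
  shows "(\<lambda>n. (\<Sum>k<n. g (real (Suc k) / real n)) / real n) \<longlonglongrightarrow> G 1 - G 0"
proof -
  have mvt: "\<exists>z. s < z \<and> z < t \<and> G t - G s = (t - s) * g z" if st: "0 \<le> s" "s < t" "t \<le> 1" for s t
  proof -
    have "continuous_on {s..t} G" using that by (intro continuous_on_subset[OF G]) auto
    moreover have "G differentiable (at x)" if "s < x" "x < t" for x
      using deriv[of x] that \<open>0 \<le> s\<close> \<open>t \<le> 1\<close> by (auto simp: real_differentiable_def)
    ultimately obtain l z where z: "s < z" "z < t" "(G has_real_derivative l) (at z)" "G t - G s = (t - s) * l"
      using MVT[OF st(2)] by blast
    moreover have "l = g z" using z deriv[of z] that by (intro DERIV_unique[OF z(3)]) auto
    ultimately show ?thesis by auto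
  qed
  have up: "(\<Sum>k<n. g (real (Suc k) / real n)) / real n \<le> G 1 - G 0" if n: "n > 0" for n
  proof -
    have "g (real (Suc k) / real n) / real n \<le> G (real (Suc k) / real n) - G (real k / real n)" if "k < n" for k
    proof -
      have d: "real (Suc k) / real n - real k / real n = 1 / real n" by (simp add: diff_divide_distrib[symmetric])
      have le: "real (Suc k) / real n \<le> 1" using that by simp
      obtain z where z: "real k / real n < z" "z < real (Suc k) / real n"
        "G (real (Suc k) / real n) - G (real k / real n) = (1 / real n) * g z"
        using mvt[of "real k / real n" "real (Suc k) / real n"] n le d by (auto simp: divide_strict_right_mono)
      have "0 < z" using z(1) by (smt (verit) divide_nonneg_nonneg of_nat_0_le_iff)
      then have "g (real (Suc k) / real n) \<le> g z" using z le by (intro anti) auto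
      then show ?thesis unfolding z(3) using n by (simp add: divide_right_mono)
    qed
    then have "(\<Sum>k<n. g (real (Suc k) / real n) / real n) \<le> (\<Sum>k<n. G (real (Suc k) / real n) - G (real k / real n))"
      by (intro sum_mono) auto
    also have "\<dots> = G 1 - G 0" using n sum_lessThan_telescope[of "\<lambda>k. G (real k / real n)" n] by simp
    finally show ?thesis by (simp add: sum_divide_distrib)
  qed
  have low: "G 1 - G (1 / real n) + g 1 / real n \<le> (\<Sum>k<n. g (real (Suc k) / real n)) / real n" if n: "n > 0" for n
  proof -
    obtain m where m: "n = Suc m" using n gr0_implies_Suc by blast
    have "G (real (Suc (Suc k)) / real n) - G (real (Suc k) / real n) \<le> g (real (Suc k) / real n) / real n" if "k < m" for k
    proof -
      have d: "real (Suc (Suc k)) / real n - real (Suc k) / real n = 1 / real n" by (simp add: diff_divide_distrib[symmetric])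
      have le: "real (Suc (Suc k)) / real n \<le> 1" using that by (simp add: m)
      obtain z where z: "real (Suc k) / real n < z" "z < real (Suc (Suc k)) / real n"
        "G (real (Suc (Suc k)) / real n) - G (real (Suc k) / real n) = (1 / real n) * g z"
        using mvt[of "real (Suc k) / real n" "real (Suc (Suc k)) / real n"] n le d by (auto simp: divide_strict_right_mono)
      have "z \<le> 1" using z(2) le by linarith
      then have "g z \<le> g (real (Suc k) / real n)" using z(1) n by (intro anti) auto
      then show ?thesis unfolding z(3) using n by (simp add: divide_right_mono)
    qed
    then have "(\<Sum>k<m. G (real (Suc (Suc k)) / real n) - G (real (Suc k) / real n)) \<le> (\<Sum>k<m. g (real (Suc k) / real n) / real n)"
      by (intro sum_mono) auto
    moreover have "(\<Sum>k<m. G (real (Suc (Suc k)) / real n) - G (real (Suc k) / real n)) = G 1 - G (1 / real n)"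
      using sum_lessThan_telescope[of "\<lambda>k. G (real (Suc k) / real n)" m] n by (simp add: m)
    moreover have "(\<Sum>k<n. g (real (Suc k) / real n)) / real n = (\<Sum>k<m. g (real (Suc k) / real n) / real n) + g 1 / real n"
      unfolding sum_divide_distrib by (simp add: m)
    ultimately show ?thesis by (simp only: add_le_cancel_right)
  qed
  have "(\<lambda>n. G (1 / real n)) \<longlonglongrightarrow> G 0"
    using lim_1_over_n by (intro continuous_on_tendsto_compose[OF G]) (auto intro!: eventually_sequentiallyI[of 1])
  moreover have "(\<lambda>n. g 1 / real n) \<longlonglongrightarrow> 0" using tendsto_mult_right[OF lim_1_over_n, of "g 1"] by simp
  ultimately have "(\<lambda>n. G 1 - G (1 / real n) + g 1 / real n) \<longlonglongrightarrow> G 1 - G 0 + 0"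
    by (intro tendsto_intros)
  then have l: "(\<lambda>n. G 1 - G (1 / real n) + g 1 / real n) \<longlonglongrightarrow> G 1 - G 0" by simp
  show ?thesis
  proof (rule tendsto_sandwich[OF _ _ l tendsto_const])
    show "\<forall>\<^sub>F n in sequentially. G 1 - G (1 / real n) + g 1 / real n \<le> (\<Sum>k<n. g (real (Suc k) / real n)) / real n"
      using eventually_gt_at_top[of 0] by (rule eventually_mono) (rule low)
    show "\<forall>\<^sub>F n in sequentially. (\<Sum>k<n. g (real (Suc k) / real n)) / real n \<le> G 1 - G 0"
      using eventually_gt_at_top[of 0] by (rule eventually_mono) (rule up)
  qed
qed

text \<open>With \<open>t = Suc k / n\<close> the summand is \<open>sqrt (1/t - a) / n\<close>. The
  case \<open>\<sigma> = 1\<close> means \<open>a = 0\<close> and needs its own primitive; there the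
  quotient \<open>arccos \<sigma> / sqrt (1 - \<sigma>^2)\<close> is 0 by the convention on
  division, whereas its limit is 1.\<close>

lemma riemann_sum_sd_LIMSEQ:
  assumes "0 \<le> \<sigma>" "\<sigma> \<le> 1"
  defines "a \<equiv> 1 - \<sigma>\<^sup>2"
  shows "(\<lambda>n. \<Sum>k<n. sqrt (real (Suc k) / real n - a * (real (Suc k) / real n)\<^sup>2) / real (Suc k))
    \<longlonglongrightarrow> (if \<sigma> = 1 then 2 else \<sigma> + arccos \<sigma> / sqrt (1 - \<sigma>\<^sup>2))"
proof -
  have a: "0 \<le> a" "a \<le> 1" using assms by (auto simp: power_le_one)
  define g where "g t = sqrt (1 / t - a)" for t
  have eq: "(\<Sum>k<n. sqrt (real (Suc k) / real n - a * (real (Suc k) / real n)\<^sup>2) / real (Suc k))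
    = (\<Sum>k<n. g (real (Suc k) / real n)) / real n" for n
  proof (cases "n = 0")
    case False
    have "sqrt (t - a * t\<^sup>2) = t * g t" if "t > 0" for t
    proof -
      have "t - a * t\<^sup>2 = t\<^sup>2 * (1 / t - a)" using that by (simp add: field_simps power2_eq_square)
      then show ?thesis using that by (simp add: g_def real_sqrt_mult)
    qed
    then have "sqrt (real (Suc k) / real n - a * (real (Suc k) / real n)\<^sup>2) / real (Suc k) =
      g (real (Suc k) / real n) / real n" for k using False by simp
    then show ?thesis by (simp only: sum_divide_distrib)
  qed simp
  have anti: "g t \<le> g s" if "0 < s" "s \<le> t" "t \<le> 1" for s t
    using that by (simp add: g_def frac_le)
  show ?thesis
  proof (cases "\<sigma> = 1")
    case True
    then have a0: "a = 0" by (simp add: a_def)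
    have "(\<lambda>n. (\<Sum>k<n. g (real (Suc k) / real n)) / real n) \<longlonglongrightarrow> 2 * sqrt 1 - 2 * sqrt 0"
    proof (rule riemann_sum_antimono_LIMSEQ[where G = "\<lambda>t. 2 * sqrt t"])
      show "((\<lambda>t. 2 * sqrt t) has_real_derivative g t) (at t)" if "0 < t" "t < 1" for t
        using that by (auto intro!: derivative_eq_intros simp: g_def a0 real_sqrt_divide field_simps)
    qed (auto intro!: continuous_intros anti)
    then show ?thesis unfolding eq using True by simp
  next
    case False
    then have s1: "\<sigma> < 1" using assms by simp
    have a0: "a > 0" using s1 assms(1) by (simp add: a_def abs_square_less_1)
    \<comment> \<open>A primitive of \<open>sqrt (1/t - a)\<close>: with \<open>b = 1 - a t\<close>
      the two summands have derivatives \<open>(1 - 2 a t) / (2 sqrt (t b))\<close> and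
      \<open>1 / (2 sqrt (t b))\<close>, which add up to \<open>sqrt (b / t)\<close>. At 1 the
      summands become \<open>\<sigma>\<close> and the \<open>arccos\<close> term.\<close>
    define G where "G t = sqrt (t - a * t\<^sup>2) + arcsin (sqrt (a * t)) / sqrt a" for t
    have at: "a * t < 1" if "0 < t" "t < 1" for t
      using mult_right_mono[of a 1 t] a that by linarith
    have "(\<lambda>n. (\<Sum>k<n. g (real (Suc k) / real n)) / real n) \<longlonglongrightarrow> G 1 - G 0"
    proof (rule riemann_sum_antimono_LIMSEQ)
      have "-1 \<le> sqrt (a * t) \<and> sqrt (a * t) \<le> 1" if "t \<in> {0..1}" for t
      proof -
        have "0 \<le> a * t" "a * t \<le> 1" using a that mult_right_mono[of a 1 t] by auto
        then show ?thesis by (meson neg_le_0_iff_le order_trans real_sqrt_ge_zero real_sqrt_le_1_iff zero_le_one)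
      qed
      then show "continuous_on {0..1} G" unfolding G_def
        using a0 by (intro continuous_intros) auto
      show "(G has_real_derivative g t) (at t)" if t: "0 < t" "t < 1" for t
      proof -
        define b where "b = 1 - a * t"
        have b: "b > 0" "t - a * t\<^sup>2 = t * b" using at[OF t] by (auto simp: b_def power2_eq_square algebra_simps)
        have sq: "sqrt (a * t) < 1" "-1 < sqrt (a * t)" using at[OF t] a0 t
          by (simp_all add: less_le_trans[of "-1" 0])
        have "((\<lambda>t. sqrt (t - a * t\<^sup>2)) has_real_derivative (1 - 2 * a * t) / (2 * sqrt (t * b))) (at t)"
        proof -
          have "0 < t - a * t\<^sup>2" using b t by simp
          then show ?thesis unfolding b(2)[symmetric]
            by (auto intro!: derivative_eq_intros simp: field_simps)
        qed
        moreover have "((\<lambda>t. arcsin (sqrt (a * t)) / sqrt a) has_real_derivative 1 / (2 * sqrt (t * b))) (at t)"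
        proof -
          have "((\<lambda>t. arcsin (sqrt (a * t))) has_real_derivative
              inverse (sqrt (1 - (sqrt (a * t))\<^sup>2)) * (inverse (sqrt (a * t)) / 2 * a)) (at t)"
          proof (rule DERIV_chain2[where f = arcsin])
            show "(arcsin has_real_derivative inverse (sqrt (1 - (sqrt (a * t))\<^sup>2))) (at (sqrt (a * t)))"
              using sq by (intro DERIV_arcsin)
            show "((\<lambda>t. sqrt (a * t)) has_real_derivative inverse (sqrt (a * t)) / 2 * a) (at t)"
              using a0 t by (intro DERIV_chain2[where f = sqrt] DERIV_real_sqrt DERIV_cmult_Id) simp
          qed
          then have "((\<lambda>t. arcsin (sqrt (a * t)) / sqrt a) has_real_derivative
              inverse (sqrt (1 - (sqrt (a * t))\<^sup>2)) * (inverse (sqrt (a * t)) / 2 * a) / sqrt a) (at t)"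
            by (rule DERIV_cdivide)
          also have "inverse (sqrt (1 - (sqrt (a * t))\<^sup>2)) * (inverse (sqrt (a * t)) / 2 * a) / sqrt a
              = inverse (sqrt b) * (inverse (sqrt a * sqrt t) / 2 * (sqrt a * sqrt a)) / sqrt a"
            using a0 t by (simp add: b_def real_sqrt_mult power_mult_distrib)
          also have "\<dots> = 1 / (2 * (sqrt t * sqrt b))"
            using a0 t b(1) by (simp add: field_simps del: real_sqrt_mult_self)
          also have "sqrt t * sqrt b = sqrt (t * b)" by (rule real_sqrt_mult[symmetric])
          finally show ?thesis .
        qed
        ultimately have "(G has_real_derivative (1 - 2 * a * t) / (2 * sqrt (t * b)) + 1 / (2 * sqrt (t * b))) (at t)"
          unfolding G_def by (rule DERIV_add)
        also have "(1 - 2 * a * t) / (2 * sqrt (t * b)) + 1 / (2 * sqrt (t * b)) = (2 * b) / (2 * sqrt (t * b))"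
          unfolding add_divide_distrib[symmetric] by (simp add: b_def)
        also have "\<dots> = b / sqrt (t * b)" by (rule mult_divide_mult_cancel_left) simp
        also have "\<dots> = sqrt b / sqrt t" using b t by (simp add: real_sqrt_mult field_simps)
        also have "\<dots> = g t" using t by (simp add: g_def b_def real_sqrt_divide[symmetric] diff_divide_distrib)
        finally show ?thesis .
      qed
    qed (rule anti)
    moreover have "G 1 - G 0 = \<sigma> + arccos \<sigma> / sqrt (1 - \<sigma>\<^sup>2)"
    proof -
      have "arcsin (sqrt (1 - \<sigma>\<^sup>2)) = arccos \<sigma>"
        using assms by (simp add: arccos_arcsin_sqrt_pos)
      then show ?thesis using assms(1) by (simp add: G_def a_def)
    qed
    ultimately show ?thesis unfolding eq using False by simp
  qed
qed

section \<open>Gaussian variables\<close>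

lemma real_max_std_normal:
  "integrable std_normal_distribution (\<lambda>x. x)"
  "(LINT x|std_normal_distribution. max 0 x) = 1 / sqrt (2 * pi)"
proof -
  show 1: "integrable std_normal_distribution (\<lambda>x. x)"
    using integrable_std_normal_distribution_moment[of 1] by simp
  have 2: "(LINT x|std_normal_distribution. x) = 0"
    using integral_std_normal_distribution_moment_odd[of 1] by simp
  have 3: "(LINT x|std_normal_distribution. \<bar>x\<bar>) = sqrt (2 / pi)"
    using std_normal_distribution_odd_moments_abs[of 0] by simp
  have "(LINT x|std_normal_distribution. max 0 x) = (LINT x|std_normal_distribution. (x + \<bar>x\<bar>) / 2)"
    by (intro Bochner_Integration.integral_cong) auto
  also have "\<dots> = sqrt (2 / pi) / 2"
    using 1 by (simp add: 2 3)
  also have "\<dots> = 1 / sqrt (2 * pi)"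
    by (simp add: real_sqrt_divide real_sqrt_mult field_simps)
  finally show "(LINT x|std_normal_distribution. max 0 x) = 1 / sqrt (2 * pi)" .
qed

text \<open>The law is that of \<open>sqrt v\<close> times a standard normal variable. This form
  needs no density and so includes \<open>v = 0\<close>.\<close>

lemma centred_normal_of_char:
  assumes M: "prob_space M" and S[measurable]: "S \<in> borel_measurable M" and v: "0 \<le> v"
    and char: "\<And>t. (CLINT x|M. iexp (t * S x)) = of_real (exp (- (t\<^sup>2 * v) / 2))"
  shows "integrable M S" "(LINT x|M. max 0 (S x)) = sqrt v / sqrt (2 * pi)"
proof -
  interpret M: prob_space M by fact
  let ?N = std_normal_distribution
  interpret N: real_distribution ?N by (rule real_dist_normal_dist)
  have "distr M borel S = distr ?N borel (\<lambda>x. sqrt v * x)"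
  proof (rule Levy_uniqueness)
    show "real_distribution (distr M borel S)" by (rule M.real_distribution_distr) simp
    show "real_distribution (distr ?N borel (\<lambda>x. sqrt v * x))" by (rule N.real_distribution_distr) simp
    have "char (distr ?N borel (\<lambda>x. sqrt v * x)) t = char ?N (t * sqrt v)" for t
      by (simp add: char_def integral_distr mult.assoc)
    moreover have "char (distr M borel S) t = of_real (exp (- (t\<^sup>2 * v) / 2))" for t
      using char[of t] by (simp add: char_def integral_distr)
    ultimately show "char (distr M borel S) = char (distr ?N borel (\<lambda>x. sqrt v * x))"
      using v by (auto simp: char_std_normal_distribution power_mult_distrib)
  qed
  note d = this
  have "integrable (distr M borel S) (\<lambda>x. x)"
    unfolding d by (subst integrable_distr_eq) (auto intro: real_max_std_normal)
  then show "integrable M S" by (subst (asm) integrable_distr_eq) auto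
  have "(LINT x|M. max 0 (S x)) = (LINT x|distr M borel S. max 0 x)" by (simp add: integral_distr)
  also have "\<dots> = (LINT x|?N. max 0 (sqrt v * x))" unfolding d by (simp add: integral_distr)
  also have "\<dots> = (LINT x|?N. sqrt v * max 0 x)"
    using v by (intro Bochner_Integration.integral_cong) (auto simp: max_def mult_le_0_iff zero_le_mult_iff)
  also have "\<dots> = sqrt v / sqrt (2 * pi)" by (simp add: real_max_std_normal)
  finally show "(LINT x|M. max 0 (S x)) = sqrt v / sqrt (2 * pi)" .
qed

text \<open>The constant and the nondegenerate case of \<open>gaussian_rv\<close> obey the same
  formula for the characteristic function, so the distinction disappears from here on.\<close>

lemma gaussian_rv_moments:
  assumes M: "prob_space M" and Y: "gaussian_rv M Y"
  shows "integrable M Y" "integrable M (\<lambda>\<omega>. (Y \<omega>)\<^sup>2)"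
    and "(LINT \<omega>|M. Y \<omega>) = 0 \<Longrightarrow> (CLINT \<omega>|M. iexp (Y \<omega>)) = of_real (exp (- (LINT \<omega>|M. (Y \<omega>)\<^sup>2) / 2))"
proof -
  interpret M: prob_space M by fact
  have Ym[measurable]: "Y \<in> borel_measurable M" using Y by (simp add: gaussian_rv_def)
  have "integrable M Y \<and> integrable M (\<lambda>\<omega>. (Y \<omega>)\<^sup>2) \<and>
    ((LINT \<omega>|M. Y \<omega>) = 0 \<longrightarrow> (CLINT \<omega>|M. iexp (Y \<omega>)) = of_real (exp (- (LINT \<omega>|M. (Y \<omega>)\<^sup>2) / 2)))"
  proof (cases "\<exists>c. AE \<omega> in M. Y \<omega> = c")
    case True
    then obtain c where c: "AE \<omega> in M. Y \<omega> = c" by auto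
    have "integrable M Y \<longleftrightarrow> integrable M (\<lambda>_. c)" using c by (intro integrable_cong_AE) auto
    moreover have "integrable M (\<lambda>\<omega>. (Y \<omega>)\<^sup>2) \<longleftrightarrow> integrable M (\<lambda>_. c\<^sup>2)" using c by (intro integrable_cong_AE) auto
    moreover have "(LINT \<omega>|M. Y \<omega>) = (LINT \<omega>|M. c)" using c by (intro integral_cong_AE) auto
    moreover have "(LINT \<omega>|M. (Y \<omega>)\<^sup>2) = (LINT \<omega>|M. c\<^sup>2)" using c by (intro integral_cong_AE) auto
    moreover have "(CLINT \<omega>|M. iexp (Y \<omega>)) = (CLINT \<omega>|M. iexp c)" using c by (intro integral_cong_AE) auto
    ultimately show ?thesis by (simp add: M.prob_space)
  next
    case False
    then obtain \<mu> s where s: "s > 0" and D: "distributed M lborel Y (normal_density \<mu> s)"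
      using Y by (auto simp: gaussian_rv_def)
    let ?N = std_normal_distribution
    define S where "S \<omega> = (Y \<omega> - \<mu>) / s" for \<omega>
    have Sm[measurable]: "S \<in> borel_measurable M" unfolding S_def by measurable
    have YS: "Y \<omega> = \<mu> + s * S \<omega>" for \<omega> using s by (simp add: S_def)
    have "distributed M lborel S std_normal_density"
      using M.normal_standard_normal_convert[OF s, of Y \<mu>] D unfolding S_def by simp
    then have "distr M lborel S = ?N" by (rule distributed_distr_eq_density)
    then have d: "distr M borel S = ?N" by (simp cong: distr_cong)
    have int: "(LINT \<omega>|M. f (S \<omega>)) = (LINT x|?N. f x)" if [measurable]: "f \<in> borel_measurable borel"
      for f :: "real \<Rightarrow> 'c::{banach, second_countable_topology}"
      unfolding d[symmetric] by (simp add: integral_distr)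
    have ible: "integrable M (\<lambda>\<omega>. f (S \<omega>)) \<longleftrightarrow> integrable ?N f" if [measurable]: "f \<in> borel_measurable borel"
      for f :: "real \<Rightarrow> real"
      unfolding d[symmetric] by (simp add: integrable_distr_eq)
    have i1: "integrable M S"
      by (rule iffD2[OF ible]) (auto intro: real_max_std_normal)
    have i2: "integrable M (\<lambda>\<omega>. (S \<omega>)\<^sup>2)"
      by (rule iffD2[OF ible]) (auto intro: integrable_std_normal_distribution_moment)
    have e1: "(LINT \<omega>|M. S \<omega>) = 0"
      using int[of "\<lambda>x. x"] integral_std_normal_distribution_moment_odd[of 1] by simp
    have e2: "(LINT \<omega>|M. (S \<omega>)\<^sup>2) = 1"
      using int[of "\<lambda>x. x\<^sup>2"] std_normal_distribution_even_moments(1)[of 1] by simp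
    have Y2: "(Y \<omega>)\<^sup>2 = \<mu>\<^sup>2 + 2 * \<mu> * s * S \<omega> + s\<^sup>2 * (S \<omega>)\<^sup>2" for \<omega>
      by (simp add: YS power2_eq_square algebra_simps)
    have "integrable M Y" unfolding YS[abs_def] using i1 by simp
    moreover have "integrable M (\<lambda>\<omega>. (Y \<omega>)\<^sup>2)" unfolding Y2 using i1 i2 by simp
    moreover have "(CLINT \<omega>|M. iexp (Y \<omega>)) = of_real (exp (- (LINT \<omega>|M. (Y \<omega>)\<^sup>2) / 2))"
      if "(LINT \<omega>|M. Y \<omega>) = 0"
    proof -
      have "(LINT \<omega>|M. Y \<omega>) = \<mu>" unfolding YS[abs_def] using i1 by (simp add: e1 M.prob_space)
      with that have \<mu>: "\<mu> = 0" by simp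
      have "(LINT \<omega>|M. (Y \<omega>)\<^sup>2) = s\<^sup>2" unfolding Y2 using i1 i2 by (simp add: e2 \<mu>)
      moreover have "(CLINT \<omega>|M. iexp (Y \<omega>)) = char ?N s"
        using int[of "\<lambda>x. iexp (s * x)"] by (simp add: YS \<mu> char_def)
      ultimately show ?thesis by (simp add: char_std_normal_distribution)
    qed
    ultimately show ?thesis by blast
  qed
  then show "integrable M Y" "integrable M (\<lambda>\<omega>. (Y \<omega>)\<^sup>2)"
    "(LINT \<omega>|M. Y \<omega>) = 0 \<Longrightarrow> (CLINT \<omega>|M. iexp (Y \<omega>)) = of_real (exp (- (LINT \<omega>|M. (Y \<omega>)\<^sup>2) / 2))"
    by auto
qed

lemma std_gaussian_vector_char:
  assumes M: "prob_space M" and Z: "std_gaussian_vector M Z"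
  shows "(CLINT \<omega>|M. iexp (Z \<omega> \<bullet> u)) = of_real (exp (- (u \<bullet> u) / 2))"
proof -
  let ?N = std_normal_distribution
  let ?f = "\<lambda>z::real^2. \<Prod>i\<in>UNIV. std_normal_density (z $ i)"
  interpret product_sigma_finite "\<lambda>_::real^2. lborel :: real measure" ..
  have D: "distributed M lborel Z ?f" using Z by (simp add: std_gaussian_vector_def)
  have Zm[measurable]: "Z \<in> borel_measurable M" using distributed_measurable[OF D] by simp
  define h where "h b x = of_real (std_normal_density x) * iexp ((u \<bullet> b) * x)" for b :: "real^2" and x
  have hint: "integrable lborel (h b)" for b
  proof -
    have "integrable lborel std_normal_density" by (rule integrable_normal_density) simp
    then show ?thesis
      by (rule Bochner_Integration.integrable_bound)
        (auto simp: h_def[abs_def] norm_mult normal_density_nonneg)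
  qed
  have hval: "(LINT x|lborel. h b x) = of_real (exp (- ((u \<bullet> b)\<^sup>2) / 2))" for b
  proof -
    have "(LINT x|lborel. h b x) = char ?N (u \<bullet> b)"
      unfolding char_def by (subst integral_density) (auto simp: h_def[abs_def] scaleR_conv_of_real normal_density_nonneg)
    then show ?thesis by (simp add: char_std_normal_distribution)
  qed
  \<comment> \<open>Lebesgue measure on \<open>real^2\<close> is the image of a product measure
    indexed by \<open>Basis\<close>. The density is a product over coordinates, so it is reindexed
    before the integral factorises.\<close>
  have B: "(Basis :: (real^2) set) = (\<lambda>i. axis i 1) ` UNIV" by (auto simp: Basis_vec_def)
  have inj: "inj (\<lambda>i. axis i 1 :: real^2)" by (auto simp: inj_def axis_eq_axis)
  have comp: "(\<Sum>b\<in>Basis. x b *\<^sub>R b) \<bullet> c = x c" if "c \<in> Basis" for x :: "real^2 \<Rightarrow> real" and c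
    using that by (rule inner_sum_left_Basis)
  have "(CLINT \<omega>|M. iexp (Z \<omega> \<bullet> u)) = (CLINT z|distr M lborel Z. iexp (z \<bullet> u))"
    by (simp add: integral_distr)
  also have "\<dots> = (CLINT z|lborel. of_real (?f z) * iexp (z \<bullet> u))"
    unfolding distributed_distr_eq_density[OF D]
    by (subst integral_density) (auto simp: prod_nonneg normal_density_nonneg scaleR_conv_of_real)
  also have "\<dots> = (CLINT z|lborel. \<Prod>b\<in>Basis. h b (z \<bullet> b))"
  proof (rule Bochner_Integration.integral_cong)
    fix z :: "real^2"
    have "(\<Prod>b\<in>Basis. h b (z \<bullet> b)) = (\<Prod>b\<in>Basis. of_real (std_normal_density (z \<bullet> b))) * (\<Prod>b\<in>Basis. iexp ((u \<bullet> b) * (z \<bullet> b)))"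
      by (simp add: h_def prod.distrib)
    also have "(\<Prod>b\<in>Basis. iexp ((u \<bullet> b) * (z \<bullet> b))) = iexp (\<Sum>b\<in>Basis. (z \<bullet> b) * (u \<bullet> b))"
      by (simp add: exp_sum sum_distrib_left mult.commute)
    also have "(\<Sum>b\<in>Basis. (z \<bullet> b) * (u \<bullet> b)) = z \<bullet> u" by (rule euclidean_inner[symmetric])
    also have "(\<Prod>b\<in>Basis. of_real (std_normal_density (z \<bullet> b)) :: complex) = of_real (?f z)"
      unfolding B by (subst prod.reindex[OF inj]) (simp add: inner_axis)
    finally show "of_real (?f z) * iexp (z \<bullet> u) = (\<Prod>b\<in>Basis. h b (z \<bullet> b))" by simp
  qed simp
  also have "\<dots> = (CLINT x|(\<Pi>\<^sub>M b\<in>Basis. lborel). \<Prod>b\<in>Basis. h b (x b))"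
  proof -
    have hm: "h b \<in> borel_measurable borel" for b unfolding h_def[abs_def] by measurable
    have 1: "(\<lambda>x::real^2 \<Rightarrow> real. \<Sum>b\<in>Basis. x b *\<^sub>R b) \<in> measurable (\<Pi>\<^sub>M b\<in>Basis. lborel) borel"
      by measurable
    have 2: "(\<lambda>z::real^2. \<Prod>b\<in>Basis. h b (z \<bullet> b)) \<in> borel_measurable borel"
      by (intro borel_measurable_prod measurable_compose[OF _ hm]) simp
    have "(CLINT z|lborel. \<Prod>b\<in>Basis. h b (z \<bullet> b)) =
      (CLINT x|(\<Pi>\<^sub>M b\<in>Basis. lborel). \<Prod>b\<in>Basis. h b ((\<Sum>b\<in>Basis. x b *\<^sub>R b) \<bullet> b))"
      unfolding lborel_eq[where 'a = "real^2"] by (rule integral_distr[OF 1 2])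
    then show ?thesis by (simp add: comp)
  qed
  also have "\<dots> = (\<Prod>b\<in>Basis. LINT x|lborel. h b x)"
    by (rule product_integral_prod) (auto intro: hint)
  also have "\<dots> = of_real (exp (\<Sum>b\<in>Basis. - ((u \<bullet> b)\<^sup>2) / 2))"
    by (simp add: hval exp_sum)
  also have "(\<Sum>b\<in>Basis. - ((u \<bullet> b)\<^sup>2) / 2) = - (u \<bullet> u) / 2"
    by (simp add: euclidean_inner[of u u] sum_negf sum_divide_distrib[symmetric] power2_eq_square)
  finally show ?thesis .
qed

section \<open>The bridge with random drift\<close>

lemma integrable_mult_of_square_integrable:
  fixes X Y :: "'a \<Rightarrow> real"
  assumes [measurable]: "X \<in> borel_measurable M" "Y \<in> borel_measurable M"
    and "integrable M (\<lambda>\<omega>. (X \<omega>)\<^sup>2)" "integrable M (\<lambda>\<omega>. (Y \<omega>)\<^sup>2)"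
  shows "integrable M (\<lambda>\<omega>. X \<omega> * Y \<omega>)"
proof (rule Bochner_Integration.integrable_bound)
  show "integrable M (\<lambda>\<omega>. (X \<omega>)\<^sup>2 + (Y \<omega>)\<^sup>2)" using assms(3,4) by (rule Bochner_Integration.integrable_add)
  have "\<bar>x * y\<bar> \<le> x\<^sup>2 + y\<^sup>2" for x y :: real
  proof -
    have "2 * (\<bar>x\<bar> * \<bar>y\<bar>) \<le> x\<^sup>2 + y\<^sup>2"
      using sum_squares_bound[of "\<bar>x\<bar>" "\<bar>y\<bar>"] by (simp add: mult.assoc)
    moreover have "0 \<le> \<bar>x\<bar> * \<bar>y\<bar>" by simp
    ultimately show ?thesis unfolding abs_mult by linarith
  qed
  then show "AE \<omega> in M. norm (X \<omega> * Y \<omega>) \<le> norm ((X \<omega>)\<^sup>2 + (Y \<omega>)\<^sup>2)" by simp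
qed measurable

text \<open>\<open>gaussian_process\<close> speaks of sums over sets of distinct times, whereas
  adjacent increments share end points. Coefficients that belong to the same time are collected
  first.\<close>

lemma gaussian_process_sum:
  fixes B :: "'i \<Rightarrow> 'w \<Rightarrow> 'a::euclidean_space"
  assumes "gaussian_process M T B" "finite I" "\<And>i. i \<in> I \<Longrightarrow> \<tau> i \<in> T"
  shows "gaussian_rv M (\<lambda>\<omega>. \<Sum>i\<in>I. c i \<bullet> B (\<tau> i) \<omega>)"
proof -
  have "(\<Sum>i\<in>I. c i \<bullet> B (\<tau> i) \<omega>) = (\<Sum>t\<in>\<tau> ` I. (\<Sum>i\<in>{i\<in>I. \<tau> i = t}. c i) \<bullet> B t \<omega>)" for \<omega>
    using assms(2) by (subst sum.image_gen[of I _ \<tau>]) (auto simp: inner_sum_left intro!: sum.cong)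
  moreover have "gaussian_rv M (\<lambda>\<omega>. \<Sum>t\<in>\<tau> ` I. (\<Sum>i\<in>{i\<in>I. \<tau> i = t}. c i) \<bullet> B t \<omega>)"
  proof -
    have "finite (\<tau> ` I)" "\<tau> ` I \<subseteq> T" using assms(2,3) by auto
    then show ?thesis
      using assms(1) unfolding gaussian_process_def
      by (elim conjE allE[where x = "\<tau> ` I"] allE[where x = "\<lambda>t. \<Sum>i\<in>{i\<in>I. \<tau> i = t}. c i"]) simp
  qed
  ultimately show ?thesis by simp
qed

text \<open>The covariance is a multiple of the identity matrix, so every projection to a unit
  vector is a scalar bridge with the same covariance, whatever the direction.\<close>

lemma bridge_projection:
  assumes M: "prob_space M" and B: "planar_brownian_bridge M B" and st: "s \<in> {0..1}" "t \<in> {0..1}"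
  shows "integrable M (\<lambda>\<omega>. B s \<omega> \<bullet> u)" "(LINT \<omega>|M. B s \<omega> \<bullet> u) = 0"
    and "integrable M (\<lambda>\<omega>. (B s \<omega> \<bullet> u) * (B t \<omega> \<bullet> u))"
    and "(LINT \<omega>|M. (B s \<omega> \<bullet> u) * (B t \<omega> \<bullet> u)) = (min s t - s * t) * (u \<bullet> u)"
proof -
  have G: "gaussian_process M {0..1} B" and E: "prob_space.expectation M (B s) = 0"
    and C: "\<And>i j. (LINT \<omega>|M. B s \<omega> $ i * B t \<omega> $ j) = (min s t - s * t) * (mat 1 :: real^2^2) $ i $ j"
    using B st unfolding planar_brownian_bridge_def by blast+
  have gp: "gaussian_rv M (\<lambda>\<omega>. B r \<omega> \<bullet> v)" if "r \<in> {0..1}" for r v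
    using gaussian_process_sum[OF G, of "{()}" "\<lambda>_. r" "\<lambda>_. v"] that by (simp add: inner_commute)
  have gc: "gaussian_rv M (\<lambda>\<omega>. B r \<omega> $ i)" if "r \<in> {0..1}" for r i
    using gp[OF that, of "axis i 1"] by (simp add: inner_axis)
  have i1: "integrable M (\<lambda>\<omega>. B r \<omega> \<bullet> v)" if "r \<in> {0..1}" for r v
    by (rule gaussian_rv_moments(1)[OF M gp[OF that]])
  show "integrable M (\<lambda>\<omega>. B s \<omega> \<bullet> u)" by (rule i1[OF st(1)])
  \<comment> \<open>Integrability must come from Gaussianity: the equation for the expectation alone
    would also hold, by default value, for a non-integrable variable.\<close>
  have "integrable M (\<lambda>\<omega>. \<Sum>b\<in>Basis. (B s \<omega> \<bullet> b) *\<^sub>R b)"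
    using i1[OF st(1)] by (intro Bochner_Integration.integrable_sum integrable_scaleR_left) auto
  then have "integrable M (B s)" by (simp add: euclidean_representation)
  then show "(LINT \<omega>|M. B s \<omega> \<bullet> u) = 0" using E by simp
  have mB: "(\<lambda>\<omega>. B r \<omega> $ i) \<in> borel_measurable M" if "r \<in> {0..1}" for r i
    using gc[OF that] by (simp add: gaussian_rv_def)
  have ip: "integrable M (\<lambda>\<omega>. B s \<omega> $ i * B t \<omega> $ j)" for i j
    by (intro integrable_mult_of_square_integrable mB st gaussian_rv_moments(2)[OF M] gc)
  have eq: "(B s \<omega> \<bullet> u) * (B t \<omega> \<bullet> u) = (\<Sum>i\<in>UNIV. \<Sum>j\<in>UNIV. (u $ i * u $ j) * (B s \<omega> $ i * B t \<omega> $ j))" for \<omega>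
    unfolding inner_vec_def sum_product by (intro sum.cong refl) simp
  show "integrable M (\<lambda>\<omega>. (B s \<omega> \<bullet> u) * (B t \<omega> \<bullet> u))"
    unfolding eq by (intro Bochner_Integration.integrable_sum integrable_mult_right ip)
  have "(LINT \<omega>|M. (B s \<omega> \<bullet> u) * (B t \<omega> \<bullet> u)) =
     (\<Sum>i\<in>UNIV. \<Sum>j\<in>UNIV. (u $ i * u $ j) * (LINT \<omega>|M. B s \<omega> $ i * B t \<omega> $ j))"
    unfolding eq using ip
    by (subst Bochner_Integration.integral_sum Bochner_Integration.integral_mult_right
        | intro Bochner_Integration.integrable_sum integrable_mult_right sum.cong refl | assumption)+
  also have "\<dots> = (min s t - s * t) * (u \<bullet> u)"
    unfolding C by (simp add: sum_2 mat_def inner_vec_def distrib_left algebra_simps)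
  finally show "(LINT \<omega>|M. (B s \<omega> \<bullet> u) * (B t \<omega> \<bullet> u)) = (min s t - s * t) * (u \<bullet> u)" .
qed

text \<open>The covariance of two increments is a mixed second difference of
  \<open>min s t - s t\<close>: the minimum contributes \<open>1/n\<close> on the diagonal only, the
  product \<open>-1/n^2\<close> everywhere. The variance of the linear combination therefore
  involves just the sum and the sum of squares of the coefficients.\<close>

lemma bridge_increment_char:
  fixes a :: "nat \<Rightarrow> real" and n m :: nat
  assumes M: "prob_space M" and B: "planar_brownian_bridge M B" and u: "norm u = 1" and mn: "m \<le> n" "n > 0"
  defines "\<beta> \<equiv> \<lambda>i \<omega>. (B (real (Suc i) / n) \<omega> - B (real i / n) \<omega>) \<bullet> u"
  shows "(CLINT \<omega>|M. iexp (\<Sum>i<m. a i * \<beta> i \<omega>)) =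
    of_real (exp (- ((\<Sum>i<m. (a i)\<^sup>2) / n - (\<Sum>i<m. a i)\<^sup>2 / (real n)\<^sup>2) / 2))"
proof -
  have G: "gaussian_process M {0..1} B" using B by (simp add: planar_brownian_bridge_def)
  have T: "real i / n \<in> {0..1}" if "i \<le> n" for i using that mn by simp
  note pr = bridge_projection[OF M B T T, of _ _ u]
  have uu: "u \<bullet> u = 1" using u by (simp add: norm_eq_1)
  define U where "U \<omega> = (\<Sum>i<m. a i * \<beta> i \<omega>)" for \<omega>
  \<comment> \<open>The Boolean component of the index selects the right or left end point of the
    increment, with coefficient \<open>a i\<close> or \<open>- a i\<close>, to reach the shape of
    \<open>gaussian_process_sum\<close>.\<close>
  have "U \<omega> = (\<Sum>p\<in>{..<m} \<times> UNIV. ((if snd p then a (fst p) else - a (fst p)) *\<^sub>R u)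
      \<bullet> B (real (if snd p then Suc (fst p) else fst p) / n) \<omega>)" for \<omega>
  proof -
    have "(\<Sum>p\<in>{..<m} \<times> UNIV. h (fst p) (snd p)) = (\<Sum>i<m. h i True + h i False)" for h :: "nat \<Rightarrow> bool \<Rightarrow> real"
      using sum.cartesian_product[of h UNIV "{..<m}"] by (simp add: case_prod_unfold UNIV_bool add.commute)
    from this[of "\<lambda>i b. ((if b then a i else - a i) *\<^sub>R u) \<bullet> B (real (if b then Suc i else i) / n) \<omega>"]
    show ?thesis
      by (simp add: U_def \<beta>_def inner_diff_left inner_diff_right inner_commute right_diff_distrib)
  qed
  moreover have "gaussian_rv M (\<lambda>\<omega>. \<Sum>p\<in>{..<m} \<times> UNIV. ((if snd p then a (fst p) else - a (fst p)) *\<^sub>R u)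
      \<bullet> B (real (if snd p then Suc (fst p) else fst p) / n) \<omega>)"
    using mn by (intro gaussian_process_sum[OF G] T) auto
  ultimately have gU: "gaussian_rv M U" by (simp add: U_def[abs_def])
  have b0: "integrable M (\<beta> i)" "(LINT \<omega>|M. \<beta> i \<omega>) = 0" if "i < m" for i
  proof -
    have le: "Suc i \<le> n" "i \<le> n" using that mn by auto
    note p = pr(1,2)[OF le(1) le(1)] pr(1,2)[OF le(2) le(2)]
    show "integrable M (\<beta> i)" "(LINT \<omega>|M. \<beta> i \<omega>) = 0"
      unfolding \<beta>_def inner_diff_left using p by (simp_all del: of_nat_Suc)
  qed
  have cov: "integrable M (\<lambda>\<omega>. \<beta> i \<omega> * \<beta> j \<omega>)"
    "(LINT \<omega>|M. \<beta> i \<omega> * \<beta> j \<omega>) = (if i = j then 1 / n else 0) - 1 / (real n)\<^sup>2" if ij: "i < m" "j < m" for i j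
  proof -
    have eq: "\<beta> i \<omega> * \<beta> j \<omega> = (B (real (Suc i) / n) \<omega> \<bullet> u) * (B (real (Suc j) / n) \<omega> \<bullet> u) - (B (real (Suc i) / n) \<omega> \<bullet> u) * (B (real j / n) \<omega> \<bullet> u)
      - ((B (real i / n) \<omega> \<bullet> u) * (B (real (Suc j) / n) \<omega> \<bullet> u) - (B (real i / n) \<omega> \<bullet> u) * (B (real j / n) \<omega> \<bullet> u))" for \<omega>
      unfolding \<beta>_def inner_diff_left by (simp only: left_diff_distrib right_diff_distrib)
    have le: "Suc i \<le> n" "Suc j \<le> n" "i \<le> n" "j \<le> n" using ij mn by auto
    note ii = pr(3)[OF le(1) le(2)] pr(3)[OF le(1) le(4)] pr(3)[OF le(3) le(2)] pr(3)[OF le(3) le(4)]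
    show "integrable M (\<lambda>\<omega>. \<beta> i \<omega> * \<beta> j \<omega>)"
      unfolding eq by (intro Bochner_Integration.integrable_diff ii)
    have mins: "min (real p / n) (real q / n) = real (min p q) / n" for p q
      using mn by (simp add: min_def divide_le_cancel)
    have "(LINT \<omega>|M. \<beta> i \<omega> * \<beta> j \<omega>) =
       (real (min (Suc i) (Suc j)) / n - real (Suc i) / n * (real (Suc j) / n)) - (real (min (Suc i) j) / n - real (Suc i) / n * (real j / n))
       - ((real (min i (Suc j)) / n - real i / n * (real (Suc j) / n)) - (real (min i j) / n - real i / n * (real j / n)))"
      unfolding eq by (simp only: Bochner_Integration.integral_diff Bochner_Integration.integrable_diff ii
          pr(4)[OF le(1) le(2)] pr(4)[OF le(1) le(4)] pr(4)[OF le(3) le(2)] pr(4)[OF le(3) le(4)] uu mins mult_1_right)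
    also have "\<dots> = real (min (Suc i) (Suc j)) / n - real (min (Suc i) j) / n - real (min i (Suc j)) / n + real (min i j) / n - 1 / (real n)\<^sup>2"
      using mn by (simp add: field_simps power2_eq_square)
    also have "real (min (Suc i) (Suc j)) / n - real (min (Suc i) j) / n - real (min i (Suc j)) / n + real (min i j) / n
      = (if i = j then 1 / n else 0)"
    proof -
      have "real (min (Suc i) (Suc j)) - real (min (Suc i) j) - real (min i (Suc j)) + real (min i j) = (if i = j then 1 else 0)"
        by (auto simp: min_def)
      then show ?thesis unfolding add_divide_distrib[symmetric] diff_divide_distrib[symmetric] by simp
    qed
    finally show "(LINT \<omega>|M. \<beta> i \<omega> * \<beta> j \<omega>) = (if i = j then 1 / n else 0) - 1 / (real n)\<^sup>2" .
  qed
  have "(LINT \<omega>|M. U \<omega>) = (\<Sum>i<m. a i * (LINT \<omega>|M. \<beta> i \<omega>))"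
    unfolding U_def using b0 by (subst Bochner_Integration.integral_sum) auto
  then have U0: "(LINT \<omega>|M. U \<omega>) = 0" using b0 by simp
  have "(LINT \<omega>|M. (U \<omega>)\<^sup>2) = (LINT \<omega>|M. (\<Sum>i<m. \<Sum>j<m. (a i * a j) * (\<beta> i \<omega> * \<beta> j \<omega>)))"
    by (simp add: U_def power2_eq_square sum_product mult.assoc mult.left_commute)
  also have "\<dots> = (\<Sum>i<m. \<Sum>j<m. (a i * a j) * (LINT \<omega>|M. \<beta> i \<omega> * \<beta> j \<omega>))"
    by (subst Bochner_Integration.integral_sum, intro Bochner_Integration.integrable_sum integrable_mult_right cov, simp, simp,
        intro sum.cong refl, subst Bochner_Integration.integral_sum, intro integrable_mult_right cov, simp, simp,
        intro sum.cong refl integral_mult_right cov) simp_all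
  also have "\<dots> = (\<Sum>i<m. \<Sum>j<m. (if i = j then a i * a j / n else 0) - (a i * a j) / (real n)\<^sup>2)"
    by (intro sum.cong refl) (simp add: cov right_diff_distrib)
  also have "\<dots> = (\<Sum>i<m. (a i)\<^sup>2) / n - (\<Sum>i<m. a i)\<^sup>2 / (real n)\<^sup>2"
    by (simp add: sum_subtractf sum.delta power2_eq_square[of "sum _ _"] sum_product sum_divide_distrib[symmetric])
      (simp add: power2_eq_square sum_divide_distrib)
  finally have "(LINT \<omega>|M. (U \<omega>)\<^sup>2) = (\<Sum>i<m. (a i)\<^sup>2) / n - (\<Sum>i<m. a i)\<^sup>2 / (real n)\<^sup>2" .
  then show ?thesis
    using gaussian_rv_moments(3)[OF M gU U0] by (simp add: U_def)
qed

text \<open>\<open>process_indep_of\<close> is a statement about generated sigma-algebras.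
  Measurability of \<open>U\<close> for the one generated by the process makes \<open>U\<close>
  independent of every function of \<open>Z\<close>, and the characteristic function of the sum
  factorises.\<close>

lemma char_sum_process_indep:
  fixes X :: "'i \<Rightarrow> 'w \<Rightarrow> 'a::euclidean_space" and Z :: "'w \<Rightarrow> 'b::euclidean_space"
  assumes M: "prob_space M" and ind: "process_indep_of M T X Z"
    and U: "U \<in> borel_measurable M" "U \<in> borel_measurable (vimage_algebra (space M) (\<lambda>\<omega>. \<lambda>t\<in>T. X t \<omega>) (\<Pi>\<^sub>M t\<in>T. borel))"
    and Z: "Z \<in> borel_measurable M" and f: "f \<in> borel_measurable borel"
  shows "(CLINT \<omega>|M. iexp (U \<omega> + f (Z \<omega>))) = (CLINT \<omega>|M. iexp (U \<omega>)) * (CLINT \<omega>|M. iexp (f (Z \<omega>)))"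
proof -
  interpret prob_space M by fact
  note [measurable] = U(1) Z f
  let ?A = "vimage_algebra (space M) (\<lambda>\<omega>. \<lambda>t\<in>T. X t \<omega>) (\<Pi>\<^sub>M t\<in>T. borel)"
  let ?B = "vimage_algebra (space M) Z borel"
  have V: "(\<lambda>\<omega>. f (Z \<omega>)) \<in> borel_measurable ?B"
    by (rule measurable_compose[OF measurable_vimage_algebra1 f]) simp
  have "indep_var borel U borel (\<lambda>\<omega>. f (Z \<omega>))"
    unfolding indep_var_eq
  proof (intro conjI)
    have sA: "sigma_sets (space M) {U -` A \<inter> space M |A. A \<in> sets borel} \<subseteq> sets ?A"
      using measurable_sets[OF U(2)] by (intro sets.sigma_sets_subset[of _ ?A, simplified]) auto
    have sB: "sigma_sets (space M) {(\<lambda>\<omega>. f (Z \<omega>)) -` A \<inter> space M |A. A \<in> sets borel} \<subseteq> sets ?B"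
      using measurable_sets[OF V] by (intro sets.sigma_sets_subset[of _ ?B, simplified]) auto
    show "indep_set (sigma_sets (space M) {U -` A \<inter> space M |A. A \<in> sets borel})
       (sigma_sets (space M) {(\<lambda>\<omega>. f (Z \<omega>)) -` A \<inter> space M |A. A \<in> sets borel})"
      using ind sA sB unfolding process_indep_of_def indep_set_def
      by (rule_tac indep_sets_mono_sets) (auto split: bool.split)
  qed simp_all
  then have "char (distr M borel (\<lambda>\<omega>. U \<omega> + f (Z \<omega>))) 1 = char (distr M borel U) 1 * char (distr M borel (\<lambda>\<omega>. f (Z \<omega>))) 1"
    by (rule char_distr_add)
  then show ?thesis by (simp add: char_def integral_distr)
qed

text \<open>The drift adds the same variable \<open>\<sigma>/n * (Z \<bullet> u)\<close> to each
  increment, so it contributes variance \<open>\<sigma>^2/n^2\<close> times the squared coefficient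
  sum. This only changes the factor of the bridge term from 1 to
  \<open>1 - \<sigma>^2\<close>.\<close>

lemma X_sigma_increment_char:
  fixes a :: "nat \<Rightarrow> real" and n m :: nat and \<sigma> :: real
  assumes M: "prob_space M" and B: "planar_brownian_bridge M B" and Z: "std_gaussian_vector M Z"
    and ind: "process_indep_of M {0..1} B Z" and u: "norm u = 1" and mn: "m \<le> n" "n > 0"
  defines "\<xi> \<equiv> \<lambda>i \<omega>. (X_sigma B Z \<sigma> (real (Suc i) / n) \<omega> - X_sigma B Z \<sigma> (real i / n) \<omega>) \<bullet> u"
  shows "(CLINT \<omega>|M. iexp (\<Sum>i<m. a i * \<xi> i \<omega>)) =
    of_real (exp (- ((\<Sum>i<m. (a i)\<^sup>2) / n - (1 - \<sigma>\<^sup>2) * (\<Sum>i<m. a i)\<^sup>2 / (real n)\<^sup>2) / 2))"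
proof -
  define \<beta> where "\<beta> i \<omega> = (B (real (Suc i) / n) \<omega> - B (real i / n) \<omega>) \<bullet> u" for i \<omega>
  define U where "U \<omega> = (\<Sum>i<m. a i * \<beta> i \<omega>)" for \<omega>
  define c where "c = \<sigma> * (\<Sum>i<m. a i) / n"
  have \<xi>: "\<xi> i \<omega> = \<beta> i \<omega> + \<sigma> / n * (Z \<omega> \<bullet> u)" for i \<omega>
    by (simp add: \<xi>_def \<beta>_def X_sigma_def inner_diff_left inner_add_left diff_divide_distrib[symmetric]
        left_diff_distrib[symmetric] add_divide_distrib distrib_left distrib_right)
  have eq: "(\<Sum>i<m. a i * \<xi> i \<omega>) = U \<omega> + c * (Z \<omega> \<bullet> u)" for \<omega>
    by (simp add: \<xi> U_def c_def distrib_left sum.distrib sum_distrib_left sum_distrib_right sum_divide_distrib mult_ac)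
  have Bm: "B t \<in> borel_measurable M" if "t \<in> {0..1}" for t
    using B that by (auto simp: planar_brownian_bridge_def gaussian_process_def)
  have Zm: "Z \<in> borel_measurable M"
    using Z by (auto simp: std_gaussian_vector_def dest: distributed_measurable)
  let ?A = "vimage_algebra (space M) (\<lambda>\<omega>. \<lambda>t\<in>{0..1}. B t \<omega>) (\<Pi>\<^sub>M t\<in>{0..1::real}. borel)"
  have T: "real i / n \<in> {0..1}" if "i \<le> n" for i using that mn by simp
  \<comment> \<open>Stated for arbitrary \<open>N\<close> because it is used twice: for
    \<open>M\<close> and for the sigma-algebra generated by the bridge.\<close>
  have UM: "U \<in> borel_measurable N" if "\<And>t. t \<in> {0..1} \<Longrightarrow> B t \<in> borel_measurable N" for N
    unfolding U_def[abs_def] \<beta>_def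
    using mn by (intro borel_measurable_sum borel_measurable_times borel_measurable_const borel_measurable_inner
        borel_measurable_diff that T) auto
  have BA: "B t \<in> borel_measurable ?A" if "t \<in> {0..1}" for t
  proof -
    have 1: "(\<lambda>\<omega>. \<lambda>t\<in>{0..1}. B t \<omega>) \<in> measurable ?A (\<Pi>\<^sub>M t\<in>{0..1::real}. borel)"
      by (rule measurable_vimage_algebra1) (auto simp: space_PiM)
    have "(\<lambda>\<omega>. (\<lambda>t\<in>{0..1}. B t \<omega>) t) \<in> borel_measurable ?A"
      by (rule measurable_compose[OF 1 measurable_component_singleton[OF that]])
    then show ?thesis using that by simp
  qed
  have "(CLINT \<omega>|M. iexp (U \<omega> + c * (Z \<omega> \<bullet> u))) = (CLINT \<omega>|M. iexp (U \<omega>)) * (CLINT \<omega>|M. iexp (c * (Z \<omega> \<bullet> u)))"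
    by (rule char_sum_process_indep[OF M ind UM[OF Bm] UM[OF BA] Zm]) auto
  also have "(CLINT \<omega>|M. iexp (U \<omega>)) = of_real (exp (- ((\<Sum>i<m. (a i)\<^sup>2) / n - (\<Sum>i<m. a i)\<^sup>2 / (real n)\<^sup>2) / 2))"
    unfolding U_def \<beta>_def by (rule bridge_increment_char[OF M B u mn])
  also have "(CLINT \<omega>|M. iexp (c * (Z \<omega> \<bullet> u))) = of_real (exp (- (c\<^sup>2) / 2))"
    using std_gaussian_vector_char[OF M Z, of "c *\<^sub>R u"] u by (simp add: norm_eq_1 power2_eq_square)
  also have "of_real (exp (- ((\<Sum>i<m. (a i)\<^sup>2) / n - (\<Sum>i<m. a i)\<^sup>2 / (real n)\<^sup>2) / 2)) * of_real (exp (- (c\<^sup>2) / 2)) =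
    (of_real (exp (- ((\<Sum>i<m. (a i)\<^sup>2) / n - (1 - \<sigma>\<^sup>2) * (\<Sum>i<m. a i)\<^sup>2 / (real n)\<^sup>2) / 2)) :: complex)"
    unfolding of_real_mult[symmetric] exp_add[symmetric]
    by (rule arg_cong[where f = "\<lambda>x. of_real (exp x)"])
      (simp add: c_def power_mult_distrib power_divide left_diff_distrib diff_divide_distrib add_divide_distrib)
  finally show ?thesis unfolding eq .
qed

text \<open>The characteristic function of the increments is symmetric in the coefficients, which
  gives the rotation invariance demanded by \<open>expectation_walk_max\<close>. Constant
  coefficients in it give the normal law of each partial sum.\<close>

lemma expectation_walk_max_X_sigma:
  fixes n :: nat and \<sigma> :: real
  assumes M: "prob_space M" and B: "planar_brownian_bridge M B" and Z: "std_gaussian_vector M Z"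
    and ind: "process_indep_of M {0..1} B Z" and u: "norm u = 1" and n: "n > 0" and \<sigma>: "0 \<le> \<sigma>" "\<sigma> \<le> 1"
  defines "\<xi> \<equiv> \<lambda>i \<omega>. (X_sigma B Z \<sigma> (real (Suc i) / n) \<omega> - X_sigma B Z \<sigma> (real i / n) \<omega>) \<bullet> u"
  shows "integrable M (\<lambda>\<omega>. walk_max (\<lambda>i. \<xi> i \<omega>) n)"
    and "(LINT \<omega>|M. walk_max (\<lambda>i. \<xi> i \<omega>) n) =
      (\<Sum>k<n. sqrt (real (Suc k) / n - (1 - \<sigma>\<^sup>2) * (real (Suc k) / n)\<^sup>2) / real (Suc k)) / sqrt (2 * pi)"
proof -
  have char: "(CLINT \<omega>|M. iexp (\<Sum>i<m. a i * \<xi> i \<omega>)) =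
    of_real (exp (- ((\<Sum>i<m. (a i)\<^sup>2) / n - (1 - \<sigma>\<^sup>2) * (\<Sum>i<m. a i)\<^sup>2 / (real n)\<^sup>2) / 2))" if "m \<le> n" for m a
    unfolding \<xi>_def by (rule X_sigma_increment_char[OF M B Z ind u that n])
  have Bm: "B t \<in> borel_measurable M" if "t \<in> {0..1}" for t
    using B that by (auto simp: planar_brownian_bridge_def gaussian_process_def)
  have Zm: "Z \<in> borel_measurable M"
    using Z by (auto simp: std_gaussian_vector_def dest: distributed_measurable)
  have \<xi>m: "\<xi> i \<in> borel_measurable M" if "i < n" for i
    unfolding \<xi>_def X_sigma_def using that Zm
    by (intro borel_measurable_inner borel_measurable_diff borel_measurable_add borel_measurable_scaleR
        borel_measurable_const Bm) auto
  have a: "0 \<le> 1 - \<sigma>\<^sup>2" "1 - \<sigma>\<^sup>2 \<le> 1" using \<sigma> by (auto simp: power_le_one)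
  have var: "0 \<le> t - (1 - \<sigma>\<^sup>2) * t\<^sup>2" if "0 \<le> t" "t \<le> 1" for t
    using that a mult_mono[of "1 - \<sigma>\<^sup>2" 1 "t\<^sup>2" t] by (simp add: power2_eq_square mult_left_le)
  have S: "(CLINT \<omega>|M. iexp (t * (\<Sum>i<Suc k. \<xi> i \<omega>))) =
      of_real (exp (- (t\<^sup>2 * (real (Suc k) / n - (1 - \<sigma>\<^sup>2) * (real (Suc k) / n)\<^sup>2)) / 2))" if "k < n" for t k
  proof -
    have e: "(\<Sum>i<Suc k. t\<^sup>2) / n - (1 - \<sigma>\<^sup>2) * (\<Sum>i<Suc k. t)\<^sup>2 / (real n)\<^sup>2 =
      t\<^sup>2 * (real (Suc k) / n - (1 - \<sigma>\<^sup>2) * (real (Suc k) / n)\<^sup>2)"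
      by (simp only: sum_constant card_lessThan power_mult_distrib power_divide right_diff_distrib) (simp add: mult_ac)
    show ?thesis unfolding sum_distrib_left e[symmetric] using that by (intro char) simp
  qed
  have int: "integrable M (\<xi> i)" if "i < n" for i
  proof (rule centred_normal_of_char(1)[OF M \<xi>m[OF that]])
    show "0 \<le> 1 / n - (1 - \<sigma>\<^sup>2) / (real n)\<^sup>2" using var[of "1 / n"] n by (simp add: power_divide)
    fix t
    \<comment> \<open>Coefficients concentrated at \<open>i\<close> extract the law of a single
      increment, from which its integrability follows.\<close>
    have "(\<Sum>j<Suc i. (if j = i then t else 0) * \<xi> j \<omega>) = t * \<xi> i \<omega>" for \<omega>
      by (simp add: if_distrib[of "\<lambda>x. x * _"] cong: if_cong)
    moreover have "(\<Sum>j<Suc i. (if j = i then t else 0)\<^sup>2) = t\<^sup>2" "(\<Sum>j<Suc i. if j = i then t else 0) = t" by simp_all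
    ultimately show "(CLINT \<omega>|M. iexp (t * \<xi> i \<omega>)) = of_real (exp (- (t\<^sup>2 * (1 / n - (1 - \<sigma>\<^sup>2) / (real n)\<^sup>2)) / 2))"
      using char[of "Suc i" "\<lambda>j. if j = i then t else 0"] that by (simp add: right_diff_distrib mult.commute)
  qed
  then show "integrable M (\<lambda>\<omega>. walk_max (\<lambda>i. \<xi> i \<omega>) n)" by (rule integrable_walk_max)
  have shift: "distr M (\<Pi>\<^sub>M i\<in>{..<m}. borel) (\<lambda>\<omega>. \<lambda>i\<in>{..<m}. \<xi> i \<omega>) =
      distr M (\<Pi>\<^sub>M i\<in>{..<m}. borel) (\<lambda>\<omega>. \<lambda>i\<in>{..<m}. \<xi> (Suc i mod m) \<omega>)" if mn: "m \<le> n" for m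
  proof (rule distr_PiM_eqI_char[OF M M])
    show "\<xi> j \<in> borel_measurable M" if "j \<in> {..<m}" for j using that mn by (intro \<xi>m) auto
    show "\<xi> (Suc j mod m) \<in> borel_measurable M" if "j \<in> {..<m}" for j
    proof (rule \<xi>m)
      have "Suc j mod m < m" using that by (intro mod_less_divisor) auto
      then show "Suc j mod m < n" using mn by simp
    qed
    fix a :: "nat \<Rightarrow> real"
    \<comment> \<open>The coefficients rotated backwards; \<open>j + m - 1\<close> instead of
      \<open>j - 1\<close> avoids truncated subtraction at \<open>j = 0\<close>.\<close>
    define b where "b j = a ((j + m - 1) mod m)" for j
    have b: "b (Suc j mod m) = a j" if "j < m" for j
      using that by (cases "Suc j = m") (auto simp: b_def)
    have "(\<Sum>j<m. a j * \<xi> (Suc j mod m) \<omega>) = (\<Sum>j<m. b j * \<xi> j \<omega>)" for \<omega>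
      using sum_rotate[of "\<lambda>j. b j * \<xi> j \<omega>" m] b by simp
    moreover have "(\<Sum>j<m. (b j)\<^sup>2) = (\<Sum>j<m. (a j)\<^sup>2)" "(\<Sum>j<m. b j) = (\<Sum>j<m. a j)"
      using sum_rotate[of "\<lambda>j. (b j)\<^sup>2" m] sum_rotate[of b m] b by simp_all
    ultimately show "(CLINT \<omega>|M. iexp (\<Sum>j<m. a j * \<xi> j \<omega>)) = (CLINT \<omega>|M. iexp (\<Sum>j<m. a j * \<xi> (Suc j mod m) \<omega>))"
      by (simp only: char[OF mn])
  qed simp
  have pos: "(LINT \<omega>|M. max 0 (\<Sum>i<Suc k. \<xi> i \<omega>)) = sqrt (real (Suc k) / n - (1 - \<sigma>\<^sup>2) * (real (Suc k) / n)\<^sup>2) / sqrt (2 * pi)"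
    if k: "k < n" for k
  proof (rule centred_normal_of_char(2)[OF M _ _ S[OF k]])
    show "(\<lambda>\<omega>. \<Sum>i<Suc k. \<xi> i \<omega>) \<in> borel_measurable M" using k by (intro borel_measurable_sum \<xi>m) auto
    show "0 \<le> real (Suc k) / n - (1 - \<sigma>\<^sup>2) * (real (Suc k) / n)\<^sup>2" using k by (intro var) auto
  qed
  have "(LINT \<omega>|M. walk_max (\<lambda>i. \<xi> i \<omega>) n) = (\<Sum>k<n. (LINT \<omega>|M. max 0 (\<Sum>i<Suc k. \<xi> i \<omega>)) / Suc k)"
    by (rule expectation_walk_max[OF M int shift])
  also have "\<dots> = (\<Sum>k<n. (sqrt (real (Suc k) / n - (1 - \<sigma>\<^sup>2) * (real (Suc k) / n)\<^sup>2) / sqrt (2 * pi)) / Suc k)"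
    by (intro sum.cong refl) (simp only: pos lessThan_iff)
  also have "\<dots> = (\<Sum>k<n. sqrt (real (Suc k) / n - (1 - \<sigma>\<^sup>2) * (real (Suc k) / n)\<^sup>2) / real (Suc k)) / sqrt (2 * pi)"
    by (simp only: sum_divide_distrib divide_divide_eq_left mult.commute)
  finally show "(LINT \<omega>|M. walk_max (\<lambda>i. \<xi> i \<omega>) n) =
      (\<Sum>k<n. sqrt (real (Suc k) / n - (1 - \<sigma>\<^sup>2) * (real (Suc k) / n)\<^sup>2) / real (Suc k)) / sqrt (2 * pi)" .
qed

text \<open>Telescoping turns increments into path values. The starting value is split off because
  the walk starts at 0, which the bridge does only almost surely.\<close>

lemma support_fun_grid_eq_walk_max:
  fixes p :: "real \<Rightarrow> 'a::real_inner" and n :: nat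
  shows "support_fun (p ` (\<lambda>k. real k / real n) ` {..n}) u =
    p 0 \<bullet> u + walk_max (\<lambda>i. (p (real (Suc i) / n) - p (real i / n)) \<bullet> u) n"
proof -
  have tel: "(\<Sum>i<k. (p (real (Suc i) / n) - p (real i / n)) \<bullet> u) = p (real k / n) \<bullet> u - p 0 \<bullet> u" for k
    using sum_lessThan_telescope[of "\<lambda>i. p (real i / n) \<bullet> u" k] by (simp add: inner_diff_left)
  have "walk_max (\<lambda>i. (p (real (Suc i) / n) - p (real i / n)) \<bullet> u) n =
    Max ((\<lambda>k. p (real k / n) \<bullet> u + - (p 0 \<bullet> u)) ` {..n})"
    unfolding walk_max_eq_Max tel by simp
  also have "\<dots> = Max ((\<lambda>k. p (real k / n) \<bullet> u) ` {..n}) + - (p 0 \<bullet> u)"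
    by (rule Max_add_commute) auto
  also have "Max ((\<lambda>k. p (real k / n) \<bullet> u) ` {..n}) = support_fun (p ` (\<lambda>k. real k / real n) ` {..n}) u"
    unfolding support_fun_def by (subst cSup_eq_Max) (auto simp: image_image)
  finally show ?thesis by simp
qed

text \<open>The starting value has mean 0, and the mean of the walk maximum is the same for all unit
  vectors. Hence \<open>u\<close> and \<open>- u\<close> contribute equally, which produces the
  factor 2.\<close>

lemma expectation_breadth_dyadics:
  assumes M: "prob_space M" and B: "planar_brownian_bridge M B" and Z: "std_gaussian_vector M Z"
    and ind: "process_indep_of M {0..1} B Z" and u: "norm u = 1" and \<sigma>: "0 \<le> \<sigma>" "\<sigma> \<le> 1"
  shows "integrable M (\<lambda>\<omega>. breadth ((\<lambda>t. X_sigma B Z \<sigma> t \<omega>) ` dyadics n) u)"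
    and "(LINT \<omega>|M. breadth ((\<lambda>t. X_sigma B Z \<sigma> t \<omega>) ` dyadics n) u) =
      2 * ((\<Sum>k<2^n. sqrt (real (Suc k) / real (2^n) - (1 - \<sigma>\<^sup>2) * (real (Suc k) / real (2^n))\<^sup>2) / real (Suc k)) / sqrt (2 * pi))"
proof -
  define N :: nat where "N = 2^n"
  have N: "N > 0" by (simp add: N_def)
  have dy: "dyadics n = (\<lambda>k. real k / real N) ` {..N}" by (simp add: dyadics_def N_def)
  have X0: "X_sigma B Z \<sigma> 0 \<omega> = B 0 \<omega>" for \<omega> by (simp add: X_sigma_def)
  have z: "(0::real) \<in> {0..1}" by simp
  let ?c = "(\<Sum>k<N. sqrt (real (Suc k) / N - (1 - \<sigma>\<^sup>2) * (real (Suc k) / N)\<^sup>2) / real (Suc k)) / sqrt (2 * pi)"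
  have s: "integrable M (\<lambda>\<omega>. support_fun ((\<lambda>t. X_sigma B Z \<sigma> t \<omega>) ` dyadics n) v)"
    "(LINT \<omega>|M. support_fun ((\<lambda>t. X_sigma B Z \<sigma> t \<omega>) ` dyadics n) v) = ?c" if v: "norm v = 1" for v
    unfolding dy support_fun_grid_eq_walk_max X0
    using bridge_projection(1,2)[OF M B z z, of v] expectation_walk_max_X_sigma[OF M B Z ind v N \<sigma>]
    by simp_all
  have u': "norm (- u) = 1" using u by simp
  show "integrable M (\<lambda>\<omega>. breadth ((\<lambda>t. X_sigma B Z \<sigma> t \<omega>) ` dyadics n) u)"
    unfolding breadth_def by (rule Bochner_Integration.integrable_add[OF s(1)[OF u] s(1)[OF u']])
  have "(LINT \<omega>|M. breadth ((\<lambda>t. X_sigma B Z \<sigma> t \<omega>) ` dyadics n) u) = ?c + ?c"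
    unfolding breadth_def Bochner_Integration.integral_add[OF s(1)[OF u] s(1)[OF u']] s(2)[OF u] s(2)[OF u'] ..
  then show "(LINT \<omega>|M. breadth ((\<lambda>t. X_sigma B Z \<sigma> t \<omega>) ` dyadics n) u) =
      2 * ((\<Sum>k<2^n. sqrt (real (Suc k) / real (2^n) - (1 - \<sigma>\<^sup>2) * (real (Suc k) / real (2^n))\<^sup>2) / real (Suc k)) / sqrt (2 * pi))"
    unfolding N_def by (simp only: mult_2)
qed

section \<open>Expected perimeter\<close>

theorem expectation_perim_K_sigma:
  assumes M: "prob_space M" and B: "planar_brownian_bridge M B" and Z: "std_gaussian_vector M Z"
    and ind: "process_indep_of M {0..1} B Z" and \<sigma>: "0 \<le> \<sigma>" "\<sigma> \<le> 1"
  shows "prob_space.expectation M (\<lambda>\<omega>. perim (K_sigma B Z \<sigma> \<omega>)) =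
    sqrt (2 * pi) * (if \<sigma> = 1 then 2 else \<sigma> + arccos \<sigma> / sqrt (1 - \<sigma>\<^sup>2))"
proof -
  interpret M: prob_space M by fact
  interpret pair_sigma_finite lborel M ..
  define L where "L = (if \<sigma> = 1 then 2 else \<sigma> + arccos \<sigma> / sqrt (1 - \<sigma>\<^sup>2))"
  define c where "c n = (\<Sum>k<n. sqrt (real (Suc k) / real n - (1 - \<sigma>\<^sup>2) * (real (Suc k) / real n)\<^sup>2) / real (Suc k)) / sqrt (2 * pi)"
    for n :: nat
  have c: "c \<longlonglongrightarrow> L / sqrt (2 * pi)"
    unfolding c_def[abs_def] L_def using riemann_sum_sd_LIMSEQ[OF \<sigma>] by (intro tendsto_divide tendsto_const) auto
  define p where "p \<omega> t = X_sigma B Z \<sigma> t \<omega>" for \<omega> t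
  define b where "b n \<theta> \<omega> = ennreal (breadth (p \<omega> ` dyadics n) (dir \<theta>) / 2) * indicator {0..2*pi} \<theta>" for n \<theta> \<omega>
  \<comment> \<open>A countable supremum of finite maxima, hence jointly measurable as Tonelli
    requires. On \<open>space M\<close>, where paths are continuous, it is half the breadth of the
    whole path, cut off to one turn of angles.\<close>
  define F where "F = (\<lambda>(\<theta>, \<omega>). SUP n. b n \<theta> \<omega>)"
  have Bm: "B t \<in> borel_measurable M" if "t \<in> {0..1}" for t
    using B that by (auto simp: planar_brownian_bridge_def gaussian_process_def)
  have Zm: "Z \<in> borel_measurable M"
    using Z by (auto simp: std_gaussian_vector_def dest: distributed_measurable)
  have pm: "(\<lambda>\<omega>. p \<omega> t) \<in> borel_measurable M" if "t \<in> {0..1}" for t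
    unfolding p_def X_sigma_def
    by (intro borel_measurable_add borel_measurable_scaleR borel_measurable_const Bm Zm that)
  have cont: "continuous_on {0..1} (p \<omega>)" if "\<omega> \<in> space M" for \<omega>
    using B that unfolding p_def X_sigma_def planar_brownian_bridge_def by (auto intro!: continuous_intros)
  have bm: "(\<lambda>(\<theta>, \<omega>). b n \<theta> \<omega>) \<in> borel_measurable (lborel \<Otimes>\<^sub>M M)" for n
  proof -
    have s: "(\<lambda>x. support_fun (p (snd x) ` dyadics n) (f (fst x))) \<in> borel_measurable (lborel \<Otimes>\<^sub>M M)"
      if f: "f \<in> borel_measurable borel" for f :: "real \<Rightarrow> real^2"
    proof -
      have "support_fun (p (snd x) ` dyadics n) (f (fst x)) = Max ((\<lambda>t. p (snd x) t \<bullet> f (fst x)) ` dyadics n)" for x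
        unfolding support_fun_def by (subst cSup_eq_Max) (auto simp: image_image)
      moreover have "(\<lambda>x. Max ((\<lambda>t. p (snd x) t \<bullet> f (fst x)) ` dyadics n)) \<in> borel_measurable (lborel \<Otimes>\<^sub>M M)"
      proof (rule borel_measurable_Max)
        fix t assume "t \<in> dyadics n"
        then have "t \<in> {0..1}" using dyadics_subset by blast
        then have "(\<lambda>x. p (snd x) t) \<in> borel_measurable (lborel \<Otimes>\<^sub>M M)"
          by (intro measurable_compose[OF measurable_snd pm])
        moreover have "(\<lambda>x. f (fst x)) \<in> borel_measurable (lborel \<Otimes>\<^sub>M M)"
          using f by (intro measurable_compose[OF measurable_fst]) simp
        ultimately show "(\<lambda>x. p (snd x) t \<bullet> f (fst x)) \<in> borel_measurable (lborel \<Otimes>\<^sub>M M)"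
          by (rule borel_measurable_inner)
      qed simp
      ultimately show ?thesis by simp
    qed
    have dirm: "dir \<in> borel_measurable borel"
      by (subst borel_measurable_euclidean_space) (simp add: inner_commute[of "dir _"] inner_dir)
    have dirm': "(\<lambda>\<theta>. - dir \<theta>) \<in> borel_measurable borel" using dirm by (rule borel_measurable_uminus)
    note [measurable] = s[OF dirm] s[OF dirm']
    show ?thesis
      unfolding b_def breadth_def case_prod_unfold by measurable
  qed
  have Fm: "F \<in> borel_measurable (lborel \<Otimes>\<^sub>M M)"
    unfolding F_def case_prod_unfold using bm unfolding case_prod_unfold by (intro borel_measurable_SUP) simp_all
  have perim: "0 \<le> perim (K_sigma B Z \<sigma> \<omega>)" "ennreal (perim (K_sigma B Z \<sigma> \<omega>)) = (\<integral>\<^sup>+\<theta>. F (\<theta>, \<omega>) \<partial>lborel)"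
    if \<omega>: "\<omega> \<in> space M" for \<omega>
  proof -
    let ?P = "p \<omega> ` {0..1}"
    have cP: "compact ?P" by (intro compact_continuous_image cont \<omega>) simp
    have K: "K_sigma B Z \<sigma> \<omega> = convex hull ?P" by (simp add: K_sigma_def p_def)
    have Kp: "convex (convex hull ?P)" "compact (convex hull ?P)" "convex hull ?P \<noteq> {}"
      using cP by (auto simp: compact_convex_hull)
    show "0 \<le> perim (K_sigma B Z \<sigma> \<omega>)" unfolding K by (rule perim_eq_nn_integral_breadth(1)[OF Kp])
    have "ennreal (perim (K_sigma B Z \<sigma> \<omega>)) = (\<integral>\<^sup>+\<theta>\<in>{0..2*pi}. ennreal (breadth ?P (dir \<theta>) / 2) \<partial>lborel)"
      unfolding K perim_eq_nn_integral_breadth(2)[OF Kp]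
      using cP by (simp add: breadth_convex_hull compact_imp_bounded)
    also have "\<dots> = (\<integral>\<^sup>+\<theta>. F (\<theta>, \<omega>) \<partial>lborel)"
    proof (rule nn_integral_cong)
      fix \<theta>
      have inc: "incseq (\<lambda>n. b n \<theta> \<omega>)"
        using breadth_dyadic_LIMSEQ(1)[OF cont[OF \<omega>], of "dir \<theta>"]
        by (auto intro!: mult_right_mono ennreal_leI simp: mono_def b_def)
      have "(\<lambda>n. b n \<theta> \<omega>) \<longlonglongrightarrow> ennreal (breadth ?P (dir \<theta>) / 2) * indicator {0..2*pi} \<theta>"
        unfolding b_def using breadth_dyadic_LIMSEQ(2)[OF cont[OF \<omega>], of "dir \<theta>"]
        by (cases "\<theta> \<in> {0..2*pi}") (auto intro!: tendsto_intros)
      then show "ennreal (breadth ?P (dir \<theta>) / 2) * indicator {0..2*pi} \<theta> = F (\<theta>, \<omega>)"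
        using LIMSEQ_unique[OF LIMSEQ_SUP[OF inc]] by (simp add: F_def)
    qed
    finally show "ennreal (perim (K_sigma B Z \<sigma> \<omega>)) = (\<integral>\<^sup>+\<theta>. F (\<theta>, \<omega>) \<partial>lborel)" .
  qed
  have dirint: "(\<integral>\<^sup>+\<omega>. F (\<theta>, \<omega>) \<partial>M) = ennreal (L / sqrt (2 * pi)) * indicator {0..2*pi} \<theta>" for \<theta>
  proof -
    have mono: "b n \<theta> \<omega> \<le> b (Suc n) \<theta> \<omega>" if "\<omega> \<in> space M" for n \<omega>
      using incseq_SucD[OF breadth_dyadic_LIMSEQ(1)[OF cont[OF that], of "dir \<theta>"], of n]
      unfolding b_def by (intro mult_right_mono ennreal_leI) auto
    have bm': "b n \<theta> \<in> borel_measurable M" for n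
      using measurable_Pair2[OF bm, of \<theta> n] by simp
    have val: "(\<integral>\<^sup>+\<omega>. b n \<theta> \<omega> \<partial>M) = ennreal (c (2^n)) * indicator {0..2*pi} \<theta>" for n
    proof -
      note e = expectation_breadth_dyadics[OF M B Z ind norm_dir[of \<theta>] \<sigma>, of n, folded p_def]
      have "(\<integral>\<^sup>+\<omega>. ennreal (breadth (p \<omega> ` dyadics n) (dir \<theta>) / 2) \<partial>M) = ennreal (LINT \<omega>|M. breadth (p \<omega> ` dyadics n) (dir \<theta>) / 2)"
      proof (rule nn_integral_eq_integral)
        show "integrable M (\<lambda>\<omega>. breadth (p \<omega> ` dyadics n) (dir \<theta>) / 2)" using e(1) by simp
        show "AE \<omega> in M. 0 \<le> breadth (p \<omega> ` dyadics n) (dir \<theta>) / 2"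
          by (intro AE_I2 divide_nonneg_nonneg breadth_nonneg finite_imp_bounded) auto
      qed
      also have "(LINT \<omega>|M. breadth (p \<omega> ` dyadics n) (dir \<theta>) / 2) = c (2^n)"
        using e(2) by (simp add: c_def)
      finally show ?thesis
        unfolding b_def by (cases "\<theta> \<in> {0..2*pi}") simp_all
    qed
    have "(\<integral>\<^sup>+\<omega>. F (\<theta>, \<omega>) \<partial>M) = (SUP n. \<integral>\<^sup>+\<omega>. b n \<theta> \<omega> \<partial>M)"
      unfolding F_def case_prod_conv
      by (rule nn_integral_monotone_convergence_SUP_AE) (auto intro: mono bm')
    moreover have "(\<lambda>n. \<integral>\<^sup>+\<omega>. b n \<theta> \<omega> \<partial>M) \<longlonglongrightarrow> (SUP n. \<integral>\<^sup>+\<omega>. b n \<theta> \<omega> \<partial>M)"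
      by (intro LIMSEQ_SUP incseq_SucI nn_integral_mono mono)
    moreover have "(\<lambda>n. \<integral>\<^sup>+\<omega>. b n \<theta> \<omega> \<partial>M) \<longlonglongrightarrow> ennreal (L / sqrt (2 * pi)) * indicator {0..2*pi} \<theta>"
    proof -
      have "(\<lambda>n. c (2^n)) \<longlonglongrightarrow> L / sqrt (2 * pi)"
        using LIMSEQ_subseq_LIMSEQ[OF c, of "\<lambda>n. 2^n"] by (simp add: strict_mono_def o_def)
      then show ?thesis unfolding val by (cases "\<theta> \<in> {0..2*pi}") (auto intro!: tendsto_intros)
    qed
    ultimately show ?thesis using LIMSEQ_unique by metis
  qed
  have "(\<integral>\<^sup>+\<omega>. ennreal (perim (K_sigma B Z \<sigma> \<omega>)) \<partial>M) = (\<integral>\<^sup>+\<omega>. (\<integral>\<^sup>+\<theta>. F (\<theta>, \<omega>) \<partial>lborel) \<partial>M)"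
    by (intro nn_integral_cong perim)
  also have "\<dots> = (\<integral>\<^sup>+\<theta>. (\<integral>\<^sup>+\<omega>. F (\<theta>, \<omega>) \<partial>M) \<partial>lborel)" by (rule Fubini[OF Fm])
  \<comment> \<open>The mean does not depend on the direction, so only the length
    \<open>2 * pi\<close> of the range of angles enters; \<open>1 / sqrt (2 * pi)\<close> comes from
    the mean positive part of a standard normal variable.\<close>
  also have "\<dots> = ennreal (L / sqrt (2 * pi)) * ennreal (2 * pi)"
    by (simp add: dirint nn_integral_cmult)
  also have "\<dots> = ennreal (L / sqrt (2 * pi) * (2 * pi))"
    by (rule ennreal_mult''[symmetric]) simp
  also have "L / sqrt (2 * pi) * (2 * pi) = sqrt (2 * pi) * L"
  proof -
    define s where "s = sqrt (2 * pi)"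
    have "2 * pi = s * s" "s \<noteq> 0" by (simp_all add: s_def)
    then show ?thesis unfolding s_def[symmetric] by simp
  qed
  finally have nn: "(\<integral>\<^sup>+\<omega>. ennreal (perim (K_sigma B Z \<sigma> \<omega>)) \<partial>M) = ennreal (sqrt (2 * pi) * L)" .
  have Lnn: "0 \<le> L"
    using \<sigma> arccos_lbound[of \<sigma>] by (auto simp: L_def power_le_one intro!: add_nonneg_nonneg divide_nonneg_nonneg)
  \<comment> \<open>The definition of \<open>perim\<close> by \<open>THE\<close> says nothing about
    measurability in \<open>\<omega>\<close>; it is inherited from the integral over
    directions.\<close>
  have pmeas: "(\<lambda>\<omega>. perim (K_sigma B Z \<sigma> \<omega>)) \<in> borel_measurable M"
  proof -
    have "(\<lambda>\<omega>. enn2real (\<integral>\<^sup>+\<theta>. F (\<theta>, \<omega>) \<partial>lborel)) \<in> borel_measurable M"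
      using measurable_pair_swap[OF Fm]
      by (intro borel_measurable_enn2real lborel.borel_measurable_nn_integral) (simp add: case_prod_unfold)
    then show ?thesis
      by (rule measurable_cong[THEN iffD1, rotated]) (simp add: perim(1) flip: perim(2))
  qed
  have "prob_space.expectation M (\<lambda>\<omega>. perim (K_sigma B Z \<sigma> \<omega>)) = enn2real (ennreal (sqrt (2 * pi) * L))"
    using perim(1) unfolding nn[symmetric] by (intro integral_eq_nn_integral pmeas AE_I2)
  then show ?thesis using Lnn by (simp add: L_def)
qed

theorem corollary3p4:
  fixes M :: "'w measure"
    and B :: "real \<Rightarrow> 'w \<Rightarrow> real^2"
    and Z :: "'w \<Rightarrow> real^2"
  assumes "prob_space M"
    and "planar_brownian_bridge M B"
    and "std_gaussian_vector M Z"
    and "process_indep_of M {0..1} B Z"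
  shows "(\<forall>\<sigma>::real. 0 \<le> \<sigma> \<and> \<sigma> < 1 \<longrightarrow>
            prob_space.expectation M (\<lambda>\<omega>. perim (K_sigma B Z \<sigma> \<omega>))
              = sqrt (2 * pi) * (\<sigma> + arccos \<sigma> / sqrt (1 - \<sigma>\<^sup>2)))
       \<and> prob_space.expectation M (\<lambda>\<omega>. perim (K_sigma B Z 1 \<omega>)) = sqrt (8 * pi)"
proof (intro conjI allI impI)
  fix \<sigma> :: real assume "0 \<le> \<sigma> \<and> \<sigma> < 1"
  then show "prob_space.expectation M (\<lambda>\<omega>. perim (K_sigma B Z \<sigma> \<omega>))
      = sqrt (2 * pi) * (\<sigma> + arccos \<sigma> / sqrt (1 - \<sigma>\<^sup>2))"
    using expectation_perim_K_sigma[OF assms, of \<sigma>] by simp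
next
  have "sqrt (8 * pi) = sqrt (2\<^sup>2 * (2 * pi))" by simp
  also have "\<dots> = sqrt (2 * pi) * 2" unfolding real_sqrt_mult by simp
  finally show "prob_space.expectation M (\<lambda>\<omega>. perim (K_sigma B Z 1 \<omega>)) = sqrt (8 * pi)"
    using expectation_perim_K_sigma[OF assms, of 1] by simp
qed

end
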